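(* Let $0<H<1$, $0<K\leq 1$ and $T>0$. Let $W^{H,K}$ be a bifractional Brownian motion with parameters $H,K$, and let $Y^{(2)}_t=2^{-K/2}W^{HK}(t)$, $0\leq t\leq T$, where $W^{HK}$ is a fractional Brownian motion with Hurst index $HK$. Let $m:[0,T]\to\mathbb{R}$ be any continuous function and $c\in\mathbb{R}$ an arbitrary constant. Then $$E\Big[\sup_{0\leq t\leq T}\{W_t^{H,K}+m(t),c\}\Big]\geq E\Big[\sup_{0\leq t\leq T}\{Y_t^{(2)}+m(t),c\}\Big].$$ In addition, if $g:\mathbb{R}\to\mathbb{R}$ is a non-decreasing convex function, then $$E\Big[g\Big(\sup_{0\leq t\leq T}(W_t^{H,K}+m(t))\Big)\Big]\geq E\Big[g\Big(\sup_{0\leq t\leq T}(Y_t^{(2)}+m(t))\Big)\Big].$$ Moreover, for any $0\leq t\leq T$, $$\int_t^\infty P\Big(\sup_{0\leq s\leq T}W_s^{H,K}>u\Big)\,du\geq\int_t^\infty P\Big(\sup_{0\leq s\leq T}Y_s^{(2)}>u\Big)\,du,$$ or equivalently, for any $0\leq t\leq T$, $$E\Big[\sup_{0\leq s\leq T}W_s^{H,K}-t\Big]_+\geq E\Big[\sup_{0\leq s\leq T}Y_s^{(2)}-t\Big]_+.$$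
   Context: A bifractional Brownian motion with parameters $H\in(0,1)$, $K\in(0,1]$ is a centered Gaussian process $\{W_t^{H,K},t\geq 0\}$ with covariance function $$C_H(s,t)=\frac{1}{2^K}\big[(t^{2H}+s^{2H})^K-|s-t|^{2HK}\big].$$ A fractional Brownian motion with Hurst index $h\in(0,1)$ is a centered Gaussian process with covariance function $\frac12(t^{2h}+s^{2h}-|t-s|^{2h})$; here $h=HK$. All processes are assumed to have almost surely continuous sample paths on $[0,T]$. For a process $Z$ and a constant $c$, $\sup_{0\leq t\leq T}\{Z_t,c\}$ denotes $\max\{\sup_{0\leq t\leq T}Z_t,\,c\}$. $E[\xi]_+$ denotes $E[\max(\xi,0)]$. *)

theory Defs
  imports "HOL-Probability.Probability"
begin

text \<open>
  Normal laws include the degenerate ones, as in the usual definition of a Gaussian process;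
  this is needed here because the processes below start from \<open>0\<close> almost surely.
\<close>

definition normal_law :: "real \<Rightarrow> real \<Rightarrow> real measure" where
  "normal_law \<mu> \<sigma> =
     (if \<sigma> = 0 then return borel \<mu> else density lborel (\<lambda>x. ennreal (normal_density \<mu> \<sigma> x)))"

definition gaussian_process ::
    "'a measure \<Rightarrow> 'i set \<Rightarrow> ('i \<Rightarrow> 'a \<Rightarrow> real) \<Rightarrow> bool" where
  "gaussian_process M I X \<longleftrightarrow>
     (\<forall>i\<in>I. X i \<in> borel_measurable M) \<and>
     (\<forall>J a. finite J \<and> J \<subseteq> I \<longrightarrow>
        (\<exists>\<mu> \<sigma>. 0 \<le> \<sigma> \<and> distr M borel (\<lambda>\<omega>. \<Sum>j\<in>J. a j * X j \<omega>) = normal_law \<mu> \<sigma>))"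

definition centered_gaussian_process_cov ::
    "'a measure \<Rightarrow> 'i set \<Rightarrow> ('i \<Rightarrow> 'i \<Rightarrow> real) \<Rightarrow> ('i \<Rightarrow> 'a \<Rightarrow> real) \<Rightarrow> bool" where
  "centered_gaussian_process_cov M I C X \<longleftrightarrow>
     gaussian_process M I X \<and>
     (\<forall>i\<in>I. (\<integral>\<omega>. X i \<omega> \<partial>M) = 0) \<and>
     (\<forall>i\<in>I. \<forall>j\<in>I. (\<integral>\<omega>. X i \<omega> * X j \<omega> \<partial>M) = C i j)"

definition bifractional_BM :: "'a measure \<Rightarrow> real \<Rightarrow> real \<Rightarrow> (real \<Rightarrow> 'a \<Rightarrow> real) \<Rightarrow> bool" where
  "bifractional_BM M H K W \<longleftrightarrow>
     0 < H \<and> H < 1 \<and> 0 < K \<and> K \<le> 1 \<and>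
     centered_gaussian_process_cov M {0..}
       (\<lambda>s t. 1 / 2 powr K *
          ((t powr (2 * H) + s powr (2 * H)) powr K - \<bar>s - t\<bar> powr (2 * H * K))) W"

definition fractional_BM :: "'a measure \<Rightarrow> real \<Rightarrow> (real \<Rightarrow> 'a \<Rightarrow> real) \<Rightarrow> bool" where
  "fractional_BM M h B \<longleftrightarrow>
     0 < h \<and> h < 1 \<and>
     centered_gaussian_process_cov M {0..}
       (\<lambda>s t. 1 / 2 * (t powr (2 * h) + s powr (2 * h) - \<bar>t - s\<bar> powr (2 * h))) B"

text \<open>
  Expectation \<open>E[\<xi>] = E[\<xi>\<^sup>+] - E[\<xi>\<^sup>-]\<close> with values in the extended reals. The Bochner integral
  would return \<open>0\<close> for non-integrable \<open>\<xi>\<close>, whereas \<open>E[g(sup \<dots>)]\<close> may be \<open>+\<infinity>\<close> for a rapidly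
  growing convex \<open>g\<close>. The value is the usual one unless both parts are infinite; this does
  not occur for the variables considered, which are almost surely bounded below because the
  processes vanish almost surely at time \<open>0\<close>.

  The completion is used because paths are continuous only almost surely: a supremum
  over \<open>[0,T]\<close> then agrees with a measurable function outside a null set, but need not be
  \<open>M\<close>-measurable itself.
\<close>

definition ext_expectation :: "'a measure \<Rightarrow> ('a \<Rightarrow> real) \<Rightarrow> ereal" where
  "ext_expectation M \<xi> =
     enn2ereal (\<integral>\<^sup>+\<omega>. ennreal (max (\<xi> \<omega>) 0) \<partial>completion M) -
     enn2ereal (\<integral>\<^sup>+\<omega>. ennreal (max (- \<xi> \<omega>) 0) \<partial>completion M)"

definition path_sup :: "real \<Rightarrow> (real \<Rightarrow> 'a \<Rightarrow> real) \<Rightarrow> 'a \<Rightarrow> real" where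
  "path_sup T Z \<omega> = (SUP t\<in>{0..T}. Z t \<omega>)"

end

theory Submission
  imports Defs
begin

text \<open>
  Both processes vanish at time \<open>0\<close>, and the increments of \<open>W\<close> have at least the variance of those
  of \<open>Y\<close>. Hence the Sudakov-Fernique inequality, applied to finitely many times together with time
  \<open>0\<close> carrying the mean \<open>c\<close>, compares the expectations of \<open>max c (Max\<^sub>j (W (t\<^sub>j) + m (t\<^sub>j)))\<close>; monotone
  convergence along a dense sequence of times passes to the supremum. Comparing \<open>E (\<xi> - c)\<^sub>+\<close> for all
  \<open>c\<close> is the increasing convex order, which covers every non-decreasing convex \<open>g\<close>.

  The Sudakov-Fernique inequality is proved by Lindeberg replacement for the smooth maximum
  \<open>log (\<Sum> exp x\<^sub>i)\<close>: in a third-order Taylor expansion the second-order term is a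
  non-negative combination of the increment variances. Lindeberg's method needs no Gaussian integration by
  parts, only that the law of a Gaussian vector is determined by its covariance, which follows from the
  one-dimensional Levy uniqueness theorem.
\<close>

section \<open>Increments of bifractional Brownian motion\<close>

text \<open>The variances differ: \<open>W\<close> has \<open>t powr (2*H*K)\<close> at time
  \<open>t\<close>, \<open>Y\<close> has \<open>1 / 2 powr K\<close> times that. So Slepian's lemma,
  which asks for equal variances, does not apply, and only expectations of maxima are compared; this
  is why the outcome is a convex order and not a comparison of distributions. The factor
  \<open>2 powr (- K / 2)\<close> makes the increment variance of \<open>Y\<close> equal to
  \<open>1 / 2 powr K * \<bar>t - s\<bar> powr (2*H*K)\<close>. With x = t^(2H), y = s^(2H), d = |t
  - s|^(2H), the increment variance of \<open>W\<close> exceeds it by 2^(-K) times (2x)^K + (2y)^K +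
  d^K - 2(x+y)^K. Concavity of the K-th power makes the first two terms fall short of 2(x+y)^K, and
  d^K has to pay for the gap. It does, because sqrt x = t^H and sqrt y = s^H differ by at most sqrt
  d. In the replacement argument, n swaps with error of order n^(-3/2) each leave a total error of
  order n^(-1/2). The third derivative of the smooth maximum is bounded independently of the base
  point, so third moments of the added vectors control the error. For rapidly growing
  \<open>g\<close> both expectations may be infinite; hence the passage to general \<open>g\<close>
  uses countable sums of ramps and monotone convergence in [0, infinity].\<close>

text \<open>For \<open>e = 1 - K\<close> this function is, up to the factor \<open>- K\<close>, the
  derivative of \<open>(1 + v) powr K + (1 - v) powr K\<close>. The second derivative is
  non-negative because a negative power is larger at \<open>1 - v\<close> than at
  \<open>1 + v\<close>.\<close>

lemma convex_powr_diff:
  fixes e :: real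
  assumes "0 \<le> e"
  shows "convex_on {0..<1} (\<lambda>v. (1 - v) powr (-e) - (1 + v) powr (-e))"
proof (rule f''_ge0_imp_convex)
  fix v :: real assume v: "v \<in> {0..<1}"
  have der: "((\<lambda>v. (1 - v) powr c) has_real_derivative - c * (1 - v) powr (c - 1)) (at v)"
            "((\<lambda>v. (1 + v) powr c) has_real_derivative c * (1 + v) powr (c - 1)) (at v)" for c
    using DERIV_fun_powr[of "\<lambda>v. 1 - v" "-1" v c] DERIV_fun_powr[of "\<lambda>v. 1 + v" 1 v c] v
    by (auto intro!: derivative_eq_intros)
  show "((\<lambda>v. (1 - v) powr (-e) - (1 + v) powr (-e)) has_real_derivative
          e * (1 - v) powr (-e - 1) + e * (1 + v) powr (-e - 1)) (at v)"
    using DERIV_diff[OF der(1)[of "-e"] der(2)[of "-e"]] by simp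
  show "((\<lambda>v. e * (1 - v) powr (-e - 1) + e * (1 + v) powr (-e - 1)) has_real_derivative
          e * (e + 1) * ((1 - v) powr (-e - 2) - (1 + v) powr (-e - 2))) (at v)"
    using DERIV_add[OF DERIV_cmult[OF der(1)[of "-e-1"], of e] DERIV_cmult[OF der(2)[of "-e-1"], of e]]
    by (simp add: algebra_simps)
  have "(1 + v) powr (-e - 2) \<le> (1 - v) powr (-e - 2)"
    using v assms by (intro powr_mono2') auto
  then show "0 \<le> e * (e + 1) * ((1 - v) powr (-e - 2) - (1 + v) powr (-e - 2))"
    using assms by simp
qed simp

text \<open>By the convexity above, the derivative of the right-hand side divided by \<open>w\<close> decreases; so the
  right-hand side is a concave function of \<open>w\<^sup>2\<close>, and the left-hand side is its chord over \<open>[0, 1]\<close>.\<close>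

lemma powr_one_plus_minus_ge:
  fixes K w :: real
  assumes K: "0 < K" "K \<le> 1" and w: "0 \<le> w" "w \<le> 1"
  shows "2 + (2 powr K - 2) * w\<^sup>2 \<le> (1 + w) powr K + (1 - w) powr K"
proof (cases "w = 0 \<or> w = 1")
  case True
  then show ?thesis using K by auto
next
  case False
  with w have w: "0 < w" "w < 1" by auto
  define f where "f v = (1 + v) powr K + (1 - v) powr K" for v :: real
  define \<psi> where "\<psi> v = (1 - v) powr (-(1-K)) - (1 + v) powr (-(1-K))" for v :: real
  \<comment> \<open>\<open>L\<close> is the slope, in the variable v^2, of the chord of
    \<open>f\<close> over [0, w], and \<open>G\<close> is \<open>f\<close> minus that chord, so
    \<open>G\<close> vanishes at 0 and at \<open>w\<close>. The goal
    \<open>2 powr K - 2 \<le> L\<close> is \<open>G 1 \<le> 0\<close>: Rolle gives a critical point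
    \<xi> of \<open>G\<close> before \<open>w\<close>, and beyond \<open>w\<close> the derivative of
    \<open>G\<close> is at most 0.\<close>
  define L where "L = (f w - 2) / w\<^sup>2"
  define G where "G v = f v - 2 - L * v\<^sup>2" for v
  have cont: "continuous_on {0..1} G"
    unfolding G_def f_def using K by (intro continuous_intros continuous_on_powr') auto
  have der: "(G has_real_derivative - K * \<psi> v - 2 * L * v) (at v)" if "0 \<le> v" "v < 1" for v
    unfolding G_def f_def \<psi>_def using that
    by (auto intro!: derivative_eq_intros simp: algebra_simps powr_diff)
  have [simp]: "G 0 = 0" "G w = 0" using w by (simp_all add: G_def f_def L_def)
  obtain \<xi> where \<xi>: "0 < \<xi>" "\<xi> < w" "- K * \<psi> \<xi> - 2 * L * \<xi> = 0"
  proof -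
    have "\<exists>z. 0 < z \<and> z < w \<and> (\<lambda>x. (- K * \<psi> z - 2 * L * z) * x) = (\<lambda>x. 0)"
      using w der by (intro Rolle_deriv[of 0 w G])
        (auto intro: continuous_on_subset[OF cont] simp: has_field_derivative_def)
    then show ?thesis using that by (metis mult.right_neutral)
  qed
  have G1: "G 1 \<le> G w"
  proof (rule DERIV_nonpos_imp_decreasing_open[where f = G and a = w and b = 1])
    fix v assume v: "w < v" "v < 1"
    \<comment> \<open>Convexity together with \<open>\<psi> 0 = 0\<close> makes
      \<open>\<psi> v / v\<close> non-decreasing; here it is compared at \<xi> < v.\<close>
    have "\<psi> ((1 - \<xi>/v) *\<^sub>R 0 + (\<xi>/v) *\<^sub>R v) \<le> (1 - \<xi>/v) * \<psi> 0 + (\<xi>/v) * \<psi> v"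
      unfolding \<psi>_def using convex_powr_diff[of "1-K"] K \<xi> v w
      by (intro convex_onD) auto
    then have "\<psi> \<xi> \<le> \<xi> / v * \<psi> v" using v w by (simp add: \<psi>_def)
    then have "K * \<psi> \<xi> \<le> K * (\<xi> / v * \<psi> v)" using K by (intro mult_left_mono) auto
    with \<xi> have "0 \<le> (2 * L + K * \<psi> v / v) * \<xi>" by (simp add: algebra_simps)
    then have "0 \<le> 2 * L + K * \<psi> v / v" using \<xi> by (simp add: zero_le_mult_iff)
    then have "0 \<le> (2 * L + K * \<psi> v / v) * v" using v w by simp
    then have "- K * \<psi> v - 2 * L * v \<le> 0" using v w by (simp add: distrib_right)
    with der[of v] v w show "\<exists>y. (G has_real_derivative y) (at v) \<and> y \<le> 0" by auto
  qed (use w in \<open>auto intro: continuous_on_subset[OF cont]\<close>)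
  then have "G 1 \<le> 0" by simp
  then have "2 powr K - 2 \<le> L" using K by (simp add: G_def f_def)
  then have "(2 powr K - 2) * w\<^sup>2 \<le> L * w\<^sup>2" by (intro mult_right_mono) auto
  then show ?thesis using w by (simp add: L_def f_def)
qed

text \<open>Write c = 2^K. By the previous bound the first two summands miss 2 by at most (2 - c)
  w^2, while the last one is |w|^(2K) / c, hence at least w^2 / c. What remains, 2 - c <= 1 / c, is
  (c - 1)^2 >= 0.\<close>

lemma powr_one_plus_minus_ge_two:
  fixes K w :: real
  assumes K: "0 < K" "K \<le> 1" and w: "\<bar>w\<bar> \<le> 1"
  shows "2 \<le> (1 + w) powr K + (1 - w) powr K + (w\<^sup>2 / 2) powr K"
proof -
  have "w\<^sup>2 \<le> 1" using w by (simp add: abs_square_le_1)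
  have "w\<^sup>2 = (w\<^sup>2) powr 1" by simp
  also have "\<dots> \<le> (w\<^sup>2) powr K" using K \<open>w\<^sup>2 \<le> 1\<close> powr_mono'[of K 1 "w\<^sup>2"]
    by (cases "w = 0") auto
  finally have 1: "w\<^sup>2 \<le> (w\<^sup>2) powr K" .
  define c :: real where "c = 2 powr K"
  have "c > 0" by (simp add: c_def)
  have "0 \<le> (c - 1)\<^sup>2" by simp
  then have "2 - c \<le> 1 / c" using \<open>c > 0\<close> by (simp add: field_simps power2_eq_square)
  then have "(2 - c) * w\<^sup>2 \<le> 1 / c * w\<^sup>2" by (intro mult_right_mono) auto
  also have "\<dots> \<le> 1 / c * (w\<^sup>2) powr K" using 1 \<open>c > 0\<close> by (intro mult_left_mono) auto
  also have "\<dots> = (w\<^sup>2 / 2) powr K" by (simp add: powr_divide c_def)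
  finally have 2: "0 \<le> (c - 2) * w\<^sup>2 + (w\<^sup>2 / 2) powr K" by (simp add: algebra_simps)
  have "2 + (c - 2) * \<bar>w\<bar>\<^sup>2 \<le> (1 + \<bar>w\<bar>) powr K + (1 - \<bar>w\<bar>) powr K"
    unfolding c_def using K w by (intro powr_one_plus_minus_ge) auto
  also have "\<dots> = (1 + w) powr K + (1 - w) powr K" by (simp add: abs_if)
  finally show ?thesis using 2 by simp
qed

text \<open>Homogeneity reduces this to one variable: with \<open>A = x + y\<close> and
  \<open>w = (x - y) / A\<close> one has 2x = A (1 + w) and 2y = A (1 - w). Since (sqrt x + sqrt
  y)^2 <= 2A, the hypothesis on \<open>d\<close> gives d >= (x - y)^2 / (2A) = A w^2 / 2, and A^K
  cancels.\<close>

lemma add_powr_le: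
  fixes K x y d :: real
  assumes K: "0 < K" "K \<le> 1" and xy: "0 \<le> x" "0 \<le> y" and d: "(sqrt x - sqrt y)\<^sup>2 \<le> d"
  shows "2 * (x + y) powr K \<le> (2 * x) powr K + (2 * y) powr K + d powr K"
proof (cases "x + y = 0")
  case True
  then show ?thesis using xy by simp
next
  case False
  define A where "A = x + y"
  define w where "w = (x - y) / A"
  have A: "A > 0" using False xy by (simp add: A_def)
  have w: "\<bar>w\<bar> \<le> 1" using xy A by (auto simp: w_def A_def abs_le_iff field_simps)
  have x: "2 * x = A * (1 + w)" and y: "2 * y = A * (1 - w)"
    using A by (auto simp: w_def A_def field_simps)
  have "(x - y)\<^sup>2 = (sqrt x - sqrt y)\<^sup>2 * (sqrt x + sqrt y)\<^sup>2"
    using xy by (simp flip: power_mult_distrib add: algebra_simps)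
  also have "\<dots> \<le> (sqrt x - sqrt y)\<^sup>2 * (2 * A)"
  proof (rule mult_left_mono)
    have "0 \<le> (sqrt x - sqrt y)\<^sup>2" by simp
    then show "(sqrt x + sqrt y)\<^sup>2 \<le> 2 * A"
      using xy by (simp add: A_def power2_sum power2_diff)
  qed simp
  finally have "(x - y)\<^sup>2 / (2 * A) \<le> (sqrt x - sqrt y)\<^sup>2" using A by (simp add: divide_le_eq)
  with d have "(x - y)\<^sup>2 / (2 * A) \<le> d" by linarith
  moreover have "(x - y)\<^sup>2 / (2 * A) = A * (w\<^sup>2 / 2)" using A by (simp add: w_def power_divide power2_eq_square)
  ultimately have "(A * (w\<^sup>2 / 2)) powr K \<le> d powr K" using A K by (intro powr_mono2) auto
  moreover have "A powr K * 2 \<le> A powr K * ((1 + w) powr K + (1 - w) powr K + (w\<^sup>2 / 2) powr K)"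
    using powr_one_plus_minus_ge_two[OF K w] by (intro mult_left_mono) auto
  moreover have "(A * (1 + w)) powr K = A powr K * (1 + w) powr K"
    "(A * (1 - w)) powr K = A powr K * (1 - w) powr K"
    "(A * (w\<^sup>2 / 2)) powr K = A powr K * (w\<^sup>2 / 2) powr K"
    using A w by (auto simp only: powr_mult abs_le_iff intro!: powr_mult)
  ultimately show ?thesis unfolding x y A_def[symmetric]
    by (simp only: distrib_left)
qed

lemma powr_diff_le_powr:
  fixes a s t :: real
  assumes "0 \<le> a" "a \<le> 1" "0 \<le> s" "0 \<le> t"
  shows "\<bar>t powr a - s powr a\<bar> \<le> \<bar>t - s\<bar> powr a"
proof -
  \<comment> \<open>Subadditivity: each share r = u / (u + v) or v / (u + v) lies in [0, 1], so r <=
    r^a, and the two shares add up to 1.\<close>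
  have *: "(u + v) powr a \<le> u powr a + v powr a" if "0 \<le> u" "0 \<le> v" for u v :: real
  proof (cases "u + v = 0")
    case False
    then have p: "u + v > 0" using that by simp
    have le: "r \<le> r powr a" if "0 \<le> r" "r \<le> 1" for r :: real
      using that assms powr_mono'[of a 1 r] by (cases "r = 0") auto
    have "1 = u / (u + v) + v / (u + v)" using p by (simp flip: add_divide_distrib)
    also have "\<dots> \<le> (u / (u + v)) powr a + (v / (u + v)) powr a"
      using that p by (intro add_mono le) auto
    finally show ?thesis using p that by (simp add: powr_divide field_simps)
  qed (use that in auto)
  show ?thesis
    using *[of s "t - s"] *[of t "s - t"] assms powr_mono2[of a s t] powr_mono2[of a t s]
    by (cases "s \<le> t") (auto simp: abs_if)
qed

text \<open>The increment variance of \<open>W\<close> is, up to the factor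
  \<open>1 / 2 powr K\<close>, the two diagonal powers minus the left-hand side plus twice
  \<open>\<bar>t - s\<bar> powr (2*H*K)\<close>. One of these two copies is the increment variance
  of \<open>Y\<close>; the inequality says that the other one covers the rest.\<close>

lemma bifractional_increment_ge:
  fixes H K s t :: real
  assumes H: "0 < H" "H < 1" and K: "0 < K" "K \<le> 1" and st: "0 \<le> s" "0 \<le> t"
  shows "2 * (t powr (2*H) + s powr (2*H)) powr K
         \<le> (2 * t powr (2*H)) powr K + (2 * s powr (2*H)) powr K + \<bar>t - s\<bar> powr (2*H*K)"
proof -
  have "(sqrt (t powr (2*H)) - sqrt (s powr (2*H)))\<^sup>2 = \<bar>t powr H - s powr H\<bar>\<^sup>2"
    by (simp add: powr_half_sqrt[symmetric] powr_powr)
  also have "\<dots> \<le> (\<bar>t - s\<bar> powr H)\<^sup>2"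
    using powr_diff_le_powr[of H s t] H st by (intro power_mono) auto
  also have "\<dots> = \<bar>t - s\<bar> powr (2*H)" by (simp add: power2_eq_square flip: powr_add)
  finally show ?thesis
    using add_powr_le[of K "t powr (2*H)" "s powr (2*H)" "\<bar>t - s\<bar> powr (2*H)"] K
    by (simp add: powr_powr)
qed

section \<open>The Cramer-Wold theorem\<close>

lemma integrable_scaleR_iexp:
  assumes "integrable M w" and [measurable]: "\<theta> \<in> borel_measurable M"
  shows "integrable M (\<lambda>\<omega>. w \<omega> *\<^sub>R iexp (\<theta> \<omega>))"
proof (rule Bochner_Integration.integrable_bound[OF assms(1)])
  have [measurable]: "w \<in> borel_measurable M" using assms(1) by auto
  show "(\<lambda>\<omega>. w \<omega> *\<^sub>R iexp (\<theta> \<omega>)) \<in> borel_measurable M" by measurable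
qed (simp add: norm_exp_i_times)

text \<open>Divided by their common total mass, the weights become probability densities, and the
  laws of \<open>U\<close> and \<open>V\<close> under them have the same characteristic function.
  The weight carries information about the other coordinates when a random vector is treated one
  coordinate at a time.\<close>

lemma weighted_Levy_uniqueness:
  fixes U :: "'a \<Rightarrow> real" and V :: "'b \<Rightarrow> real"
  assumes w: "integrable M w" "\<And>\<omega>. 0 \<le> w \<omega>" and v: "integrable N v" "\<And>\<omega>. 0 \<le> v \<omega>"
    and [measurable]: "U \<in> borel_measurable M" "V \<in> borel_measurable N" "A \<in> sets borel"
    and eq: "\<And>s. (\<integral>\<omega>. w \<omega> *\<^sub>R iexp (s * U \<omega>) \<partial>M) = (\<integral>\<omega>. v \<omega> *\<^sub>R iexp (s * V \<omega>) \<partial>N)"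
  shows "(\<integral>\<omega>. w \<omega> * indicator A (U \<omega>) \<partial>M) = (\<integral>\<omega>. v \<omega> * indicator A (V \<omega>) \<partial>N)"
proof -
  have [measurable]: "w \<in> borel_measurable M" "v \<in> borel_measurable N"
    using w(1) v(1) by auto
  define c where "c = (\<integral>\<omega>. w \<omega> \<partial>M)"
  \<comment> \<open>The transforms at \<open>s = 0\<close> are the total masses.\<close>
  have c: "c = (\<integral>\<omega>. v \<omega> \<partial>N)"
    using eq[of 0] by (simp add: c_def scaleR_conv_of_real)
  have "0 \<le> c" unfolding c_def using w by simp
  show ?thesis
  proof (cases "c = 0")
    case True
    have "AE \<omega> in M. w \<omega> = 0"
      using True w by (subst (asm) c_def, subst (asm) integral_nonneg_eq_0_iff_AE) auto
    moreover have "AE \<omega> in N. v \<omega> = 0"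
      using True v by (subst (asm) c, subst (asm) integral_nonneg_eq_0_iff_AE) auto
    ultimately have "(\<integral>\<omega>. w \<omega> * indicator A (U \<omega>) \<partial>M) = 0"
      "(\<integral>\<omega>. v \<omega> * indicator A (V \<omega>) \<partial>N) = 0"
      by (auto intro!: integral_eq_zero_AE elim: eventually_mono)
    then show ?thesis by simp
  next
    case False
    with \<open>0 \<le> c\<close> have "c > 0" by simp
    define P where "P = distr (density M (\<lambda>\<omega>. ennreal (w \<omega> / c))) borel U"
    define Q where "Q = distr (density N (\<lambda>\<omega>. ennreal (v \<omega> / c))) borel V"
    have "(\<integral>\<^sup>+\<omega>. ennreal (w \<omega> / c) \<partial>M) = 1" "(\<integral>\<^sup>+\<omega>. ennreal (v \<omega> / c) \<partial>N) = 1"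
      using w v \<open>c > 0\<close> c c_def by (subst nn_integral_eq_integral; simp)+
    then have "prob_space (density M (\<lambda>\<omega>. ennreal (w \<omega> / c)))"
        "prob_space (density N (\<lambda>\<omega>. ennreal (v \<omega> / c)))"
      by (auto intro!: prob_spaceI simp: emeasure_density cong: nn_integral_cong)
    then have "real_distribution P" "real_distribution Q"
      unfolding P_def Q_def by (auto intro!: prob_space.real_distribution_distr)
    have "char P s = (\<integral>\<omega>. w \<omega> *\<^sub>R iexp (s * U \<omega>) \<partial>M) /\<^sub>R c" for s
      using \<open>c > 0\<close> w unfolding char_def P_def
      by (simp add: integral_distr integral_density divide_inverse_commute
          flip: integral_scaleR_right scaleR_scaleR)
    moreover have "char Q s = (\<integral>\<omega>. v \<omega> *\<^sub>R iexp (s * V \<omega>) \<partial>N) /\<^sub>R c" for s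
      using \<open>c > 0\<close> v unfolding char_def Q_def
      by (simp add: integral_distr integral_density divide_inverse_commute
          flip: integral_scaleR_right scaleR_scaleR)
    ultimately have "char P = char Q" using eq by auto
    with \<open>real_distribution P\<close> \<open>real_distribution Q\<close> have "P = Q" by (rule Levy_uniqueness)
    moreover have "(\<integral>x. indicator A x \<partial>P) = (\<integral>\<omega>. w \<omega> * indicator A (U \<omega>) \<partial>M) / c"
    proof -
      have "(\<integral>x. indicator A x \<partial>P) = (\<integral>\<omega>. indicator A (U \<omega>) \<partial>density M (\<lambda>\<omega>. ennreal (w \<omega> / c)) :: real)"
        unfolding P_def by (rule integral_distr) auto
      also have "\<dots> = (\<integral>\<omega>. (w \<omega> / c) *\<^sub>R indicator A (U \<omega>) \<partial>M)"
        using w \<open>c > 0\<close> by (intro integral_density) auto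
      finally show ?thesis by simp
    qed
    moreover have "(\<integral>x. indicator A x \<partial>Q) = (\<integral>\<omega>. v \<omega> * indicator A (V \<omega>) \<partial>N) / c"
    proof -
      have "(\<integral>x. indicator A x \<partial>Q) = (\<integral>\<omega>. indicator A (V \<omega>) \<partial>density N (\<lambda>\<omega>. ennreal (v \<omega> / c)) :: real)"
        unfolding Q_def by (rule integral_distr) auto
      also have "\<dots> = (\<integral>\<omega>. (v \<omega> / c) *\<^sub>R indicator A (V \<omega>) \<partial>N)"
        using v \<open>c > 0\<close> by (intro integral_density) auto
      finally show ?thesis by simp
    qed
    ultimately show ?thesis using \<open>c > 0\<close> by simp
  qed
qed

lemma one_plus_cos_iexp:
  "(w * (1 + cos x)) *\<^sub>R iexp y = w *\<^sub>R iexp y + (1/2) * (w *\<^sub>R iexp (y + x)) + (1/2) * (w *\<^sub>R iexp (y - x))"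
  unfolding cis_conv_exp[symmetric] by (simp add: complex_eq_iff cos_add cos_diff sin_add sin_diff field_simps)

lemma one_plus_sin_iexp:
  "(w * (1 + sin x)) *\<^sub>R iexp y = w *\<^sub>R iexp y + (1/(2*\<i>)) * (w *\<^sub>R iexp (y + x)) + (-1/(2*\<i>)) * (w *\<^sub>R iexp (y - x))"
  unfolding cis_conv_exp[symmetric]
  by (simp add: complex_eq_iff cos_add cos_diff sin_add sin_diff field_simps Re_divide Im_divide)

lemma integral_linear_combination3:
  fixes f g h :: "'a \<Rightarrow> complex"
  assumes "integrable M f" "integrable M g" "integrable M h"
  shows "(\<integral>x. f x + c * g x + d * h x \<partial>M) = integral\<^sup>L M f + c * integral\<^sup>L M g + d * integral\<^sup>L M h"
  using assms by simp

text \<open>Levy's uniqueness theorem needs non-negative weights, so \<open>exp (i \<theta>)\<close> is reached through the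
  weights \<open>1 + cos \<theta>\<close> and \<open>1 + sin \<theta>\<close>.\<close>

lemma iexp_weight_indicator:
  fixes U :: "'a \<Rightarrow> real" and V :: "'b \<Rightarrow> real"
  assumes w: "integrable M w" "\<And>\<omega>. 0 \<le> w \<omega>" and v: "integrable N v" "\<And>\<omega>. 0 \<le> v \<omega>"
    and [measurable]: "U \<in> borel_measurable M" "V \<in> borel_measurable N" "A \<in> sets borel"
      "\<theta> \<in> borel_measurable M" "\<eta> \<in> borel_measurable N"
    and eq: "\<And>s r. (\<integral>\<omega>. w \<omega> *\<^sub>R iexp (s * U \<omega> + r * \<theta> \<omega>) \<partial>M)
                  = (\<integral>\<omega>. v \<omega> *\<^sub>R iexp (s * V \<omega> + r * \<eta> \<omega>) \<partial>N)"
  shows "(\<integral>\<omega>. (w \<omega> * indicator A (U \<omega>)) *\<^sub>R iexp (\<theta> \<omega>) \<partial>M)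
       = (\<integral>\<omega>. (v \<omega> * indicator A (V \<omega>)) *\<^sub>R iexp (\<eta> \<omega>) \<partial>N)"
proof -
  have [measurable]: "w \<in> borel_measurable M" "v \<in> borel_measurable N"
    using w(1) v(1) by auto
  have int: "integrable M (\<lambda>\<omega>. w \<omega> * f \<omega>)"
    if "f \<in> borel_measurable M" "\<And>\<omega>. \<bar>f \<omega>\<bar> \<le> 2" for f
    using that w mult_left_mono[OF that(2) w(2)]
    by (intro Bochner_Integration.integrable_bound[OF integrable_mult_right[OF w(1), of 2]])
      (auto simp: abs_mult mult.commute)
  have int': "integrable N (\<lambda>\<omega>. v \<omega> * f \<omega>)"
    if "f \<in> borel_measurable N" "\<And>\<omega>. \<bar>f \<omega>\<bar> \<le> 2" for f
    using that v mult_left_mono[OF that(2) v(2)]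
    by (intro Bochner_Integration.integrable_bound[OF integrable_mult_right[OF v(1), of 2]])
      (auto simp: abs_mult mult.commute)
  note ii = integrable_scaleR_iexp[OF w(1)] integrable_scaleR_iexp[OF v(1)]
  have bnd: "\<bar>1 + cos x\<bar> \<le> 2" "\<bar>1 + sin x\<bar> \<le> 2" "0 \<le> 1 + cos x" "0 \<le> 1 + sin x"
    "\<bar>indicator A y :: real\<bar> \<le> 2" "\<bar>indicator A y * cos x\<bar> \<le> 2" "\<bar>indicator A y * sin x\<bar> \<le> 2" for x y :: real
    using cos_ge_minus_one[of x] sin_ge_minus_one[of x] cos_le_one[of x] sin_le_one[of x]
    by (auto simp: abs_if split: split_indicator simp del: cos_ge_minus_one sin_ge_minus_one cos_le_one sin_le_one)
  \<comment> \<open>Uniqueness is applied with the weights \<open>w\<close>,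
    \<open>w * (1 + cos \<theta>)\<close> and \<open>w * (1 + sin \<theta>)\<close>. Subtracting the
    first result from the other two leaves the cosine and sine parts of
    \<open>iexp \<theta>\<close>.\<close>
  have I1: "(\<integral>\<omega>. w \<omega> * indicator A (U \<omega>) \<partial>M) = (\<integral>\<omega>. v \<omega> * indicator A (V \<omega>) \<partial>N)"
    using eq[of _ 0] by (intro weighted_Levy_uniqueness w v) auto
  have e1: "(\<integral>\<omega>. w \<omega> *\<^sub>R iexp (s * U \<omega> + \<theta> \<omega>) \<partial>M) = (\<integral>\<omega>. v \<omega> *\<^sub>R iexp (s * V \<omega> + \<eta> \<omega>) \<partial>N)"
    and e2: "(\<integral>\<omega>. w \<omega> *\<^sub>R iexp (s * U \<omega> - \<theta> \<omega>) \<partial>M) = (\<integral>\<omega>. v \<omega> *\<^sub>R iexp (s * V \<omega> - \<eta> \<omega>) \<partial>N)"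
    and e3: "(\<integral>\<omega>. w \<omega> *\<^sub>R iexp (s * U \<omega>) \<partial>M) = (\<integral>\<omega>. v \<omega> *\<^sub>R iexp (s * V \<omega>) \<partial>N)" for s
    using eq[of s 1] eq[of s "-1"] eq[of s 0] by simp_all
  have "(\<integral>\<omega>. (w \<omega> * (1 + cos (\<theta> \<omega>))) * indicator A (U \<omega>) \<partial>M)
      = (\<integral>\<omega>. (v \<omega> * (1 + cos (\<eta> \<omega>))) * indicator A (V \<omega>) \<partial>N)"
  proof (rule weighted_Levy_uniqueness)
    fix s
    show "(\<integral>\<omega>. (w \<omega> * (1 + cos (\<theta> \<omega>))) *\<^sub>R iexp (s * U \<omega>) \<partial>M)
        = (\<integral>\<omega>. (v \<omega> * (1 + cos (\<eta> \<omega>))) *\<^sub>R iexp (s * V \<omega>) \<partial>N)"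
      unfolding one_plus_cos_iexp
      by (subst (1 2) integral_linear_combination3) (simp_all only: e1 e2 e3, auto intro!: ii simp del: of_real_add of_real_diff of_real_mult)
  qed (use w v bnd in \<open>auto intro!: int int' mult_nonneg_nonneg\<close>)
  moreover have "(\<integral>\<omega>. (w \<omega> * (1 + sin (\<theta> \<omega>))) * indicator A (U \<omega>) \<partial>M)
      = (\<integral>\<omega>. (v \<omega> * (1 + sin (\<eta> \<omega>))) * indicator A (V \<omega>) \<partial>N)"
  proof (rule weighted_Levy_uniqueness)
    fix s
    show "(\<integral>\<omega>. (w \<omega> * (1 + sin (\<theta> \<omega>))) *\<^sub>R iexp (s * U \<omega>) \<partial>M)
        = (\<integral>\<omega>. (v \<omega> * (1 + sin (\<eta> \<omega>))) *\<^sub>R iexp (s * V \<omega>) \<partial>N)"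
      unfolding one_plus_sin_iexp
      by (subst (1 2) integral_linear_combination3) (simp_all only: e1 e2 e3, auto intro!: ii simp del: of_real_add of_real_diff of_real_mult)
  qed (use w v bnd in \<open>auto intro!: int int' mult_nonneg_nonneg\<close>)
  moreover have intA: "integrable M (\<lambda>\<omega>. w \<omega> * indicator A (U \<omega>))" "integrable N (\<lambda>\<omega>. v \<omega> * indicator A (V \<omega>))"
    "integrable M (\<lambda>\<omega>. w \<omega> * (indicator A (U \<omega>) * cos (\<theta> \<omega>)))"
    "integrable N (\<lambda>\<omega>. v \<omega> * (indicator A (V \<omega>) * cos (\<eta> \<omega>)))"
    "integrable M (\<lambda>\<omega>. w \<omega> * (indicator A (U \<omega>) * sin (\<theta> \<omega>)))"
    "integrable N (\<lambda>\<omega>. v \<omega> * (indicator A (V \<omega>) * sin (\<eta> \<omega>)))"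
    by (rule int int', measurable, rule bnd)+
  ultimately have
    c: "(\<integral>\<omega>. w \<omega> * (indicator A (U \<omega>) * cos (\<theta> \<omega>)) \<partial>M) = (\<integral>\<omega>. v \<omega> * (indicator A (V \<omega>) * cos (\<eta> \<omega>)) \<partial>N)" and
    s: "(\<integral>\<omega>. w \<omega> * (indicator A (U \<omega>) * sin (\<theta> \<omega>)) \<partial>M) = (\<integral>\<omega>. v \<omega> * (indicator A (V \<omega>) * sin (\<eta> \<omega>)) \<partial>N)"
    using I1 by (simp_all add: algebra_simps)
  have "(\<integral>\<omega>. (w \<omega> * indicator A (U \<omega>)) *\<^sub>R iexp (\<theta> \<omega>) \<partial>M)
    = (\<integral>\<omega>. complex_of_real (w \<omega> * (indicator A (U \<omega>) * cos (\<theta> \<omega>))) + \<i> * complex_of_real (w \<omega> * (indicator A (U \<omega>) * sin (\<theta> \<omega>))) \<partial>M)"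
    unfolding cis_conv_exp[symmetric] by (intro Bochner_Integration.integral_cong) (auto simp: complex_eq_iff)
  also have "\<dots> = complex_of_real (\<integral>\<omega>. w \<omega> * (indicator A (U \<omega>) * cos (\<theta> \<omega>)) \<partial>M) + \<i> * complex_of_real (\<integral>\<omega>. w \<omega> * (indicator A (U \<omega>) * sin (\<theta> \<omega>)) \<partial>M)"
    using intA by (simp del: of_real_mult)
  also have "\<dots> = (\<integral>\<omega>. complex_of_real (v \<omega> * (indicator A (V \<omega>) * cos (\<eta> \<omega>))) + \<i> * complex_of_real (v \<omega> * (indicator A (V \<omega>) * sin (\<eta> \<omega>))) \<partial>N)"
    unfolding c s using intA by (simp del: of_real_mult)
  also have "\<dots> = (\<integral>\<omega>. (v \<omega> * indicator A (V \<omega>)) *\<^sub>R iexp (\<eta> \<omega>) \<partial>N)"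
    unfolding cis_conv_exp[symmetric] by (intro Bochner_Integration.integral_cong) (auto simp: complex_eq_iff)
  finally show ?thesis .
qed

text \<open>The exponential factors are traded for indicators one coordinate at a time. In
  \<open>box\<close> the coordinates in \<open>J\<close> already stand under indicators, whose
  product is a non-negative weight, and the others still stand in the exponent. For
  \<open>J = I\<close> the probabilities of all rectangles agree, and these determine the joint
  law.\<close>

theorem Cramer_Wold:
  fixes U :: "'i \<Rightarrow> 'a \<Rightarrow> real" and V :: "'i \<Rightarrow> 'b \<Rightarrow> real"
  assumes "prob_space M" "prob_space N" and fin: "finite I"
    and U[measurable]: "\<And>i. i \<in> I \<Longrightarrow> U i \<in> borel_measurable M"
    and V[measurable]: "\<And>i. i \<in> I \<Longrightarrow> V i \<in> borel_measurable N"
    and eq: "\<And>a. (\<integral>\<omega>. iexp (\<Sum>i\<in>I. a i * U i \<omega>) \<partial>M) = (\<integral>\<omega>. iexp (\<Sum>i\<in>I. a i * V i \<omega>) \<partial>N)"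
  shows "distr M (\<Pi>\<^sub>M i\<in>I. borel) (\<lambda>\<omega>. \<lambda>i\<in>I. U i \<omega>) = distr N (\<Pi>\<^sub>M i\<in>I. borel) (\<lambda>\<omega>. \<lambda>i\<in>I. V i \<omega>)"
proof -
  interpret M: prob_space M by fact
  interpret N: prob_space N by fact
  have box: "(\<integral>\<omega>. (\<Prod>j\<in>J. indicator (A j) (U j \<omega>)) *\<^sub>R iexp (\<Sum>i\<in>I-J. a i * U i \<omega>) \<partial>M)
      = (\<integral>\<omega>. (\<Prod>j\<in>J. indicator (A j) (V j \<omega>)) *\<^sub>R iexp (\<Sum>i\<in>I-J. a i * V i \<omega>) \<partial>N)"
    if "J \<subseteq> I" and A: "\<And>i. i \<in> I \<Longrightarrow> A i \<in> sets borel" for J A a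
    using finite_subset[OF \<open>J \<subseteq> I\<close> fin] \<open>J \<subseteq> I\<close>
  proof (induction J arbitrary: a rule: finite_subset_induct')
    case empty
    then show ?case using eq[of a] by simp
  next
    case (insert j J)
    have [measurable]: "A i \<in> sets borel" if "i \<in> I" for i using A that .
    have J: "i \<in> I" if "i \<in> J" for i using insert that by auto
    have b1: "\<bar>\<Prod>j\<in>J. indicator (A j) (f j) :: real\<bar> \<le> 1" for f
      by (auto simp: abs_prod intro!: prod_le_1 split: split_indicator)
    \<comment> \<open>The free frequency \<open>s\<close> of coordinate \<open>j\<close> and the
      factor \<open>r\<close> on the remaining exponent are absorbed into a new coefficient family,
      which is why the induction keeps \<open>a\<close> arbitrary.\<close>
    have split: "s * f j + r * (\<Sum>i\<in>I - insert j J. a i * f i)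
        = (\<Sum>i\<in>I-J. (if i = j then s else r * a i) * f i)" for s r :: real and f :: "'i \<Rightarrow> real"
    proof -
      have "I - J - {j} = I - insert j J" by auto
      then have "(\<Sum>i\<in>I-J. (if i = j then s else r * a i) * f i)
          = s * f j + (\<Sum>i\<in>I - insert j J. (if i = j then s else r * a i) * f i)"
        using fin insert by (subst sum.remove[of _ j]) auto
      also have "(\<Sum>i\<in>I - insert j J. (if i = j then s else r * a i) * f i)
          = (\<Sum>i\<in>I - insert j J. r * (a i * f i))"
        by (intro sum.cong) auto
      finally show ?thesis by (simp add: sum_distrib_left)
    qed
    have "(\<integral>\<omega>. ((\<Prod>j\<in>J. indicator (A j) (U j \<omega>)) * indicator (A j) (U j \<omega>)) *\<^sub>R iexp (\<Sum>i\<in>I - insert j J. a i * U i \<omega>) \<partial>M)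
       = (\<integral>\<omega>. ((\<Prod>j\<in>J. indicator (A j) (V j \<omega>)) * indicator (A j) (V j \<omega>)) *\<^sub>R iexp (\<Sum>i\<in>I - insert j J. a i * V i \<omega>) \<partial>N)"
    proof (rule iexp_weight_indicator)
      show "integrable M (\<lambda>\<omega>. \<Prod>j\<in>J. indicator (A j) (U j \<omega>) :: real)"
        by (rule M.integrable_const_bound[where B=1]) (use J b1 in auto)
      show "integrable N (\<lambda>\<omega>. \<Prod>j\<in>J. indicator (A j) (V j \<omega>) :: real)"
        by (rule N.integrable_const_bound[where B=1]) (use J b1 in auto)
      show "0 \<le> (\<Prod>j\<in>J. indicator (A j) (U j \<omega>) :: real)" for \<omega> by (intro prod_nonneg) auto
      show "0 \<le> (\<Prod>j\<in>J. indicator (A j) (V j \<omega>) :: real)" for \<omega> by (intro prod_nonneg) auto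
      show "U j \<in> borel_measurable M" "V j \<in> borel_measurable N" "A j \<in> sets borel"
        using insert A by auto
      show "(\<lambda>\<omega>. \<Sum>i\<in>I - insert j J. a i * U i \<omega>) \<in> borel_measurable M"
        "(\<lambda>\<omega>. \<Sum>i\<in>I - insert j J. a i * V i \<omega>) \<in> borel_measurable N"
        by (auto intro!: borel_measurable_sum)
      show "(\<integral>\<omega>. (\<Prod>j\<in>J. indicator (A j) (U j \<omega>)) *\<^sub>R iexp (s * U j \<omega> + r * (\<Sum>i\<in>I - insert j J. a i * U i \<omega>)) \<partial>M)
        = (\<integral>\<omega>. (\<Prod>j\<in>J. indicator (A j) (V j \<omega>)) *\<^sub>R iexp (s * V j \<omega> + r * (\<Sum>i\<in>I - insert j J. a i * V i \<omega>)) \<partial>N)"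
        for s r
        using insert.IH[of "\<lambda>i. if i = j then s else r * a i"] by (simp only: split[symmetric])
    qed
    then show ?case using insert by (simp add: mult.commute)
  qed
  show ?thesis
  proof (rule measure_eqI_PiM_finite[OF fin])
    fix A :: "'i \<Rightarrow> real set" assume A: "\<And>i. i \<in> I \<Longrightarrow> A i \<in> sets borel"
    have ind: "(\<Prod>j\<in>I. indicator (A j) (f j)) = (indicator (Pi\<^sub>E I A) (\<lambda>i\<in>I. f i) :: real)" for f
      using fin by (auto simp: indicator_def prod_zero_iff PiE_iff)
    have [measurable]: "Pi\<^sub>E I A \<in> sets (\<Pi>\<^sub>M i\<in>I. borel)" using A fin by (intro sets_PiM_I_finite) auto
    have "measure (distr M (\<Pi>\<^sub>M i\<in>I. borel) (\<lambda>\<omega>. \<lambda>i\<in>I. U i \<omega>)) (Pi\<^sub>E I A)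
        = (\<integral>x. indicator (Pi\<^sub>E I A) x \<partial>distr M (\<Pi>\<^sub>M i\<in>I. borel) (\<lambda>\<omega>. \<lambda>i\<in>I. U i \<omega>))"
      by simp
    also have "\<dots> = (\<integral>\<omega>. indicator (Pi\<^sub>E I A) (\<lambda>i\<in>I. U i \<omega>) \<partial>M)"
      by (subst integral_distr) auto
    also have "\<dots> = (\<integral>\<omega>. indicator (Pi\<^sub>E I A) (\<lambda>i\<in>I. V i \<omega>) \<partial>N)"
      using box[of I A "\<lambda>_. 0"] A
      by (simp add: scaleR_conv_of_real of_real_prod[symmetric] ind del: of_real_prod)
    also have "\<dots> = (\<integral>x. indicator (Pi\<^sub>E I A) x \<partial>distr N (\<Pi>\<^sub>M i\<in>I. borel) (\<lambda>\<omega>. \<lambda>i\<in>I. V i \<omega>))"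
      by (subst integral_distr) auto
    also have "\<dots> = measure (distr N (\<Pi>\<^sub>M i\<in>I. borel) (\<lambda>\<omega>. \<lambda>i\<in>I. V i \<omega>)) (Pi\<^sub>E I A)"
      by simp
    finally show "emeasure (distr M (\<Pi>\<^sub>M i\<in>I. borel) (\<lambda>\<omega>. \<lambda>i\<in>I. U i \<omega>)) (Pi\<^sub>E I A)
        = emeasure (distr N (\<Pi>\<^sub>M i\<in>I. borel) (\<lambda>\<omega>. \<lambda>i\<in>I. V i \<omega>)) (Pi\<^sub>E I A)"
      using M.prob_space_distr[of "\<lambda>\<omega>. \<lambda>i\<in>I. U i \<omega>" "\<Pi>\<^sub>M i\<in>I. borel"]
        N.prob_space_distr[of "\<lambda>\<omega>. \<lambda>i\<in>I. V i \<omega>" "\<Pi>\<^sub>M i\<in>I. borel"]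
      by (simp add: prob_space_def finite_measure.emeasure_eq_measure)
  next
    show "range (\<lambda>_::nat. Pi\<^sub>E I (\<lambda>_. UNIV)) \<subseteq> prod_algebra I (\<lambda>_. borel :: real measure)"
      using fin by (auto intro!: prod_algebraI_finite)
    show "(\<Union>i::nat. Pi\<^sub>E I (\<lambda>_. UNIV)) = space (\<Pi>\<^sub>M i\<in>I. borel :: real measure)"
      by (simp add: space_PiM)
    show "emeasure (distr M (\<Pi>\<^sub>M i\<in>I. borel) (\<lambda>\<omega>. \<lambda>i\<in>I. U i \<omega>)) (Pi\<^sub>E I (\<lambda>_. UNIV)) \<noteq> \<infinity>"
      using M.prob_space_distr[of "\<lambda>\<omega>. \<lambda>i\<in>I. U i \<omega>" "\<Pi>\<^sub>M i\<in>I. borel"]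
      by (simp add: prob_space_def finite_measure.emeasure_eq_measure)
  qed simp_all
qed

section \<open>Gaussian vectors\<close>

lemma normal_law_mean:
  assumes [measurable]: "X \<in> borel_measurable M" and "0 \<le> \<sigma>"
    and law: "distr M borel X = normal_law \<mu> \<sigma>"
  shows "integrable M X" and "(\<integral>\<omega>. X \<omega> \<partial>M) = \<mu>"
proof -
  have "integrable (normal_law \<mu> \<sigma>) (\<lambda>x. x) \<and> (\<integral>x. x \<partial>normal_law \<mu> \<sigma>) = \<mu>"
  proof (cases "\<sigma> = 0")
    case True
    then show ?thesis
      by (auto simp: normal_law_def integral_return integrable_iff_bounded nn_integral_return)
  next
    case False
    with \<open>0 \<le> \<sigma>\<close> have "\<sigma> > 0" by simp
    then show ?thesis
      by (auto simp: normal_law_def integrable_density integral_density integral_normal_moment_nz_1 integrable_normal_moment_nz_1)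
  qed
  then show "integrable M X" "(\<integral>\<omega>. X \<omega> \<partial>M) = \<mu>"
    unfolding law[symmetric] by (auto simp: integrable_distr_eq integral_distr)
qed

lemma normal_law_centered:
  assumes [measurable]: "X \<in> borel_measurable M" and "0 \<le> \<sigma>"
    and law: "distr M borel X = normal_law 0 \<sigma>"
  shows "integrable M (\<lambda>\<omega>. \<bar>X \<omega>\<bar> ^ k)" and "(\<integral>\<omega>. (X \<omega>)\<^sup>2 \<partial>M) = \<sigma>\<^sup>2"
    and "(\<integral>\<omega>. iexp (X \<omega>) \<partial>M) = complex_of_real (exp (- \<sigma>\<^sup>2 / 2))"
proof -
  have "integrable (normal_law 0 \<sigma>) (\<lambda>x. \<bar>x\<bar> ^ k) \<and> (\<integral>x. x\<^sup>2 \<partial>normal_law 0 \<sigma>) = \<sigma>\<^sup>2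
    \<and> (\<integral>x. iexp x \<partial>normal_law 0 \<sigma>) = complex_of_real (exp (- \<sigma>\<^sup>2 / 2))"
  proof (cases "\<sigma> = 0")
    case True
    then show ?thesis
      by (auto simp: normal_law_def integral_return integrable_iff_bounded nn_integral_return)
  next
    case False
    with \<open>0 \<le> \<sigma>\<close> have "\<sigma> > 0" by simp
    have 1: "integrable (normal_law 0 \<sigma>) (\<lambda>x. \<bar>x\<bar> ^ k)"
      using \<open>\<sigma> > 0\<close> integrable_normal_moment_abs[of \<sigma> 0 k]
      by (auto simp: normal_law_def integrable_density)
    have 2: "(\<integral>x. x\<^sup>2 \<partial>normal_law 0 \<sigma>) = \<sigma>\<^sup>2"
      using \<open>\<sigma> > 0\<close> integral_normal_moment_even[of \<sigma> 0 1]
      by (simp add: normal_law_def integral_density fact_numeral)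
    interpret L: prob_space "density lborel (normal_density 0 \<sigma>)"
      using \<open>\<sigma> > 0\<close> by (rule prob_space_normal_density)
    have "distributed (density lborel (normal_density 0 \<sigma>)) lborel (\<lambda>x. x) (normal_density 0 \<sigma>)"
      by (simp add: distributed_def distr_id2)
    then have "distributed (density lborel (normal_density 0 \<sigma>)) lborel (\<lambda>x. (x - 0) / \<sigma>) std_normal_density"
      by (subst (asm) L.normal_standard_normal_convert[OF \<open>\<sigma> > 0\<close>])
    then have std: "distr (density lborel (normal_density 0 \<sigma>)) lborel (\<lambda>x. x / \<sigma>) = std_normal_distribution"
      unfolding distributed_def by simp
    have "(\<integral>x. iexp x \<partial>normal_law 0 \<sigma>) = (\<integral>x. iexp (\<sigma> * (x / \<sigma>)) \<partial>density lborel (normal_density 0 \<sigma>))"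
      using \<open>\<sigma> > 0\<close> by (simp add: normal_law_def)
    also have "\<dots> = (\<integral>x. iexp (\<sigma> * x) \<partial>distr (density lborel (normal_density 0 \<sigma>)) lborel (\<lambda>x. x / \<sigma>))"
      by (subst integral_distr) auto
    also have "\<dots> = char std_normal_distribution \<sigma>"
      unfolding std char_def ..
    finally have 3: "(\<integral>x. iexp x \<partial>normal_law 0 \<sigma>) = complex_of_real (exp (- \<sigma>\<^sup>2 / 2))"
      by (simp add: char_std_normal_distribution)
    from 1 2 3 show ?thesis by blast
  qed
  then show "integrable M (\<lambda>\<omega>. \<bar>X \<omega>\<bar> ^ k)" "(\<integral>\<omega>. (X \<omega>)\<^sup>2 \<partial>M) = \<sigma>\<^sup>2"
    "(\<integral>\<omega>. iexp (X \<omega>) \<partial>M) = complex_of_real (exp (- \<sigma>\<^sup>2 / 2))"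
    unfolding law[symmetric] by (auto simp: integrable_distr_eq integral_distr)
qed

text \<open>Centered Gaussian vectors with covariance matrix \<open>C\<close>, described by their
  characteristic function. In this form degenerate covariances need no case distinction, independent
  sums become products, and the hypothesis of \<open>Cramer_Wold\<close> is immediate for two
  vectors with the same \<open>C\<close>.\<close>

definition gaussian_vector ::
    "'a measure \<Rightarrow> 'i set \<Rightarrow> ('i \<Rightarrow> 'i \<Rightarrow> real) \<Rightarrow> ('i \<Rightarrow> 'a \<Rightarrow> real) \<Rightarrow> bool" where
  "gaussian_vector M I C X \<longleftrightarrow>
     (\<forall>i\<in>I. X i \<in> borel_measurable M) \<and>
     (\<forall>a. (\<integral>\<omega>. iexp (\<Sum>i\<in>I. a i * X i \<omega>) \<partial>M) = complex_of_real (exp (- (\<Sum>i\<in>I. \<Sum>j\<in>I. a i * a j * C i j) / 2)))"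

text \<open>The process definition leaves the mean of each combination open; linearity of the
  integral forces it to be 0. Linearity requires each coordinate to be integrable, which follows
  from its own normal law, taken as a combination over a singleton.\<close>

lemma centered_gaussian_process_law:
  assumes X: "centered_gaussian_process_cov M I C X" and J: "finite J" "J \<subseteq> I"
  obtains \<sigma> where "0 \<le> \<sigma>" "distr M borel (\<lambda>\<omega>. \<Sum>j\<in>J. a j * X j \<omega>) = normal_law 0 \<sigma>"
proof -
  have m[measurable]: "X i \<in> borel_measurable M" and m0: "(\<integral>\<omega>. X i \<omega> \<partial>M) = 0" if "i \<in> I" for i
    using X that by (auto simp: centered_gaussian_process_cov_def gaussian_process_def)
  have g: "\<exists>\<mu> \<sigma>. 0 \<le> \<sigma> \<and> distr M borel (\<lambda>\<omega>. \<Sum>j\<in>J. a j * X j \<omega>) = normal_law \<mu> \<sigma>"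
    if "finite J" "J \<subseteq> I" for J a
    using X that by (auto simp: centered_gaussian_process_cov_def gaussian_process_def)
  have int: "integrable M (X i)" if i: "i \<in> I" for i
  proof -
    obtain \<mu> \<sigma> where "0 \<le> \<sigma>" "distr M borel (X i) = normal_law \<mu> \<sigma>"
      using g[of "{i}" "\<lambda>_. 1"] i by auto
    then show ?thesis using normal_law_mean(1)[of "X i" M \<sigma> \<mu>] m[OF i] by auto
  qed
  obtain \<mu> \<sigma> where *: "0 \<le> \<sigma>" "distr M borel (\<lambda>\<omega>. \<Sum>j\<in>J. a j * X j \<omega>) = normal_law \<mu> \<sigma>"
    using g[OF J] by blast
  have "\<mu> = (\<integral>\<omega>. (\<Sum>j\<in>J. a j * X j \<omega>) \<partial>M)"
    using J by (intro normal_law_mean(2)[OF _ *, symmetric] borel_measurable_sum borel_measurable_times m) auto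
  also have "\<dots> = 0"
    using J m0 int by (subst Bochner_Integration.integral_sum) (auto intro!: sum.neutral)
  finally show ?thesis using * that by blast
qed

lemma centered_gaussian_process_integrable:
  assumes X: "centered_gaussian_process_cov M I C X" and i: "i \<in> I"
  shows "integrable M (\<lambda>\<omega>. \<bar>X i \<omega>\<bar> ^ k)" and "integrable M (X i)"
proof -
  have m[measurable]: "X i \<in> borel_measurable M"
    using X i by (auto simp: centered_gaussian_process_cov_def gaussian_process_def)
  obtain \<sigma> where *: "0 \<le> \<sigma>" "distr M borel (\<lambda>\<omega>. \<Sum>j\<in>{i}. 1 * X j \<omega>) = normal_law 0 \<sigma>"
    using centered_gaussian_process_law[OF X, of "{i}" "\<lambda>_. 1"] i by auto
  then show "integrable M (\<lambda>\<omega>. \<bar>X i \<omega>\<bar> ^ k)" for k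
    by (intro normal_law_centered(1)[OF m, of \<sigma>]) auto
  from this[of 1] show "integrable M (X i)" by (simp add: integrable_abs_iff)
qed

lemma centered_gaussian_process_integrable_mult:
  assumes X: "centered_gaussian_process_cov M I C X" and "i \<in> I" "j \<in> I"
  shows "integrable M (\<lambda>\<omega>. X i \<omega> * X j \<omega>)"
proof -
  have m[measurable]: "X i \<in> borel_measurable M" "X j \<in> borel_measurable M"
    using assms by (auto simp: centered_gaussian_process_cov_def gaussian_process_def)
  have le: "norm (X i \<omega> * X j \<omega>) \<le> norm (\<bar>X i \<omega>\<bar> ^ 2 + \<bar>X j \<omega>\<bar> ^ 2)" for \<omega>
  proof -
    have "2 * \<bar>X i \<omega>\<bar> * \<bar>X j \<omega>\<bar> \<le> \<bar>X i \<omega>\<bar> ^ 2 + \<bar>X j \<omega>\<bar> ^ 2" by (rule sum_squares_bound)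
    moreover have "0 \<le> \<bar>X i \<omega>\<bar> * \<bar>X j \<omega>\<bar>" by simp
    ultimately have "\<bar>X i \<omega>\<bar> * \<bar>X j \<omega>\<bar> \<le> \<bar>X i \<omega>\<bar> ^ 2 + \<bar>X j \<omega>\<bar> ^ 2" by linarith
    then show ?thesis by (simp add: abs_mult)
  qed
  have "integrable M (\<lambda>\<omega>. \<bar>X i \<omega>\<bar> ^ 2 + \<bar>X j \<omega>\<bar> ^ 2)"
    using centered_gaussian_process_integrable(1)[OF X] assms(2,3)
    by (intro Bochner_Integration.integrable_add)
  then show ?thesis
    by (rule Bochner_Integration.integrable_bound) (use le in auto)
qed

lemma gaussian_vector_process:
  assumes X: "centered_gaussian_process_cov M I C X" and I: "finite I"
  shows "gaussian_vector M I C X"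
  unfolding gaussian_vector_def
proof safe
  show m: "X i \<in> borel_measurable M" if "i \<in> I" for i
    using X that by (auto simp: centered_gaussian_process_cov_def gaussian_process_def)
  fix a
  define S where "S = (\<lambda>\<omega>. \<Sum>i\<in>I. a i * X i \<omega>)"
  have [measurable]: "S \<in> borel_measurable M"
    unfolding S_def using m by (intro borel_measurable_sum borel_measurable_times) auto
  obtain \<sigma> where *: "0 \<le> \<sigma>" "distr M borel S = normal_law 0 \<sigma>"
    using centered_gaussian_process_law[OF X I order_refl, of a] unfolding S_def by blast
  note int = centered_gaussian_process_integrable_mult[OF X]
  have "\<sigma>\<^sup>2 = (\<integral>\<omega>. (S \<omega>)\<^sup>2 \<partial>M)"
    using * by (intro normal_law_centered(2)[symmetric]) auto
  also have "\<dots> = (\<integral>\<omega>. (\<Sum>i\<in>I. \<Sum>j\<in>I. a i * a j * (X i \<omega> * X j \<omega>)) \<partial>M)"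
    by (simp add: S_def power2_eq_square sum_product mult_ac)
  also have "\<dots> = (\<Sum>i\<in>I. \<Sum>j\<in>I. a i * a j * (\<integral>\<omega>. X i \<omega> * X j \<omega> \<partial>M))"
    using int by (simp add: Bochner_Integration.integral_sum)
  also have "\<dots> = (\<Sum>i\<in>I. \<Sum>j\<in>I. a i * a j * C i j)"
    using X by (auto simp: centered_gaussian_process_cov_def intro!: sum.cong)
  finally have "\<sigma>\<^sup>2 = \<dots>" .
  moreover have "(\<integral>\<omega>. iexp (S \<omega>) \<partial>M) = complex_of_real (exp (- \<sigma>\<^sup>2 / 2))"
    using * by (intro normal_law_centered(3)) auto
  ultimately show "(\<integral>\<omega>. iexp (\<Sum>i\<in>I. a i * X i \<omega>) \<partial>M) = complex_of_real (exp (- (\<Sum>i\<in>I. \<Sum>j\<in>I. a i * a j * C i j) / 2))"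
    by (simp add: S_def)
qed

lemma pair_integrable_mult:
  fixes f :: "'a \<Rightarrow> 'c::{real_normed_field, banach, second_countable_topology}"
  assumes "prob_space M" "prob_space N" and f: "integrable M f" and g: "integrable N g"
  shows "integrable (M \<Otimes>\<^sub>M N) (\<lambda>\<omega>. f (fst \<omega>) * g (snd \<omega>))" (is ?int)
    and "(\<integral>\<omega>. f (fst \<omega>) * g (snd \<omega>) \<partial>(M \<Otimes>\<^sub>M N)) = (\<integral>x. f x \<partial>M) * (\<integral>y. g y \<partial>N)"
proof -
  interpret M: prob_space M by fact
  interpret N: prob_space N by fact
  interpret pair_prob_space M N ..
  have [measurable]: "f \<in> borel_measurable M" "g \<in> borel_measurable N" using f g by auto
  show ?int
    using f g by (intro Fubini_integrable) (auto simp: norm_mult)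
  from integral_fst'[OF this] show "(\<integral>\<omega>. f (fst \<omega>) * g (snd \<omega>) \<partial>(M \<Otimes>\<^sub>M N)) = (\<integral>x. f x \<partial>M) * (\<integral>y. g y \<partial>N)"
    using f g by simp
qed

text \<open>Independent copies are modelled by the two factors of a product space. The
  characteristic function of the sum is then the product of the two, so the exponents, and with them
  the covariances, add.\<close>

lemma gaussian_vector_pair:
  assumes "prob_space M" "prob_space N" and X: "gaussian_vector M I C X" and Y: "gaussian_vector N I D Y"
  shows "gaussian_vector (M \<Otimes>\<^sub>M N) I (\<lambda>i j. \<alpha>\<^sup>2 * C i j + \<beta>\<^sup>2 * D i j)
           (\<lambda>i \<omega>. \<alpha> * X i (fst \<omega>) + \<beta> * Y i (snd \<omega>))"
  unfolding gaussian_vector_def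
proof safe
  interpret M: prob_space M by fact
  interpret N: prob_space N by fact
  have [measurable]: "X i \<in> borel_measurable M" "Y i \<in> borel_measurable N" if "i \<in> I" for i
    using X Y that by (auto simp: gaussian_vector_def)
  show "(\<lambda>\<omega>. \<alpha> * X i (fst \<omega>) + \<beta> * Y i (snd \<omega>)) \<in> borel_measurable (M \<Otimes>\<^sub>M N)" if "i \<in> I" for i
    using that by measurable
  fix a
  have split: "iexp (\<Sum>i\<in>I. a i * (\<alpha> * X i (fst \<omega>) + \<beta> * Y i (snd \<omega>)))
     = iexp (\<Sum>i\<in>I. (a i * \<alpha>) * X i (fst \<omega>)) * iexp (\<Sum>i\<in>I. (a i * \<beta>) * Y i (snd \<omega>))" for \<omega>
  proof -
    have "(\<Sum>i\<in>I. a i * (\<alpha> * X i (fst \<omega>) + \<beta> * Y i (snd \<omega>)))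
      = (\<Sum>i\<in>I. (a i * \<alpha>) * X i (fst \<omega>)) + (\<Sum>i\<in>I. (a i * \<beta>) * Y i (snd \<omega>))"
      by (simp add: sum.distrib distrib_left mult.assoc)
    then show ?thesis by (simp add: distrib_left exp_add del: of_real_sum)
  qed
  have "(\<integral>\<omega>. iexp (\<Sum>i\<in>I. a i * (\<alpha> * X i (fst \<omega>) + \<beta> * Y i (snd \<omega>))) \<partial>(M \<Otimes>\<^sub>M N))
    = (\<integral>x. iexp (\<Sum>i\<in>I. (a i * \<alpha>) * X i x) \<partial>M) * (\<integral>y. iexp (\<Sum>i\<in>I. (a i * \<beta>) * Y i y) \<partial>N)"
    unfolding split by (intro pair_integrable_mult assms M.integrable_iexp N.integrable_iexp) auto
  also have "(\<integral>x. iexp (\<Sum>i\<in>I. (a i * \<alpha>) * X i x) \<partial>M)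
      = complex_of_real (exp (- (\<Sum>i\<in>I. \<Sum>j\<in>I. (a i * \<alpha>) * (a j * \<alpha>) * C i j) / 2))"
    by (rule X[unfolded gaussian_vector_def, THEN conjunct2, THEN spec, of "\<lambda>i. a i * \<alpha>"])
  also have "(\<integral>y. iexp (\<Sum>i\<in>I. (a i * \<beta>) * Y i y) \<partial>N)
      = complex_of_real (exp (- (\<Sum>i\<in>I. \<Sum>j\<in>I. (a i * \<beta>) * (a j * \<beta>) * D i j) / 2))"
    by (rule Y[unfolded gaussian_vector_def, THEN conjunct2, THEN spec, of "\<lambda>i. a i * \<beta>"])
  also have "complex_of_real (exp (- (\<Sum>i\<in>I. \<Sum>j\<in>I. (a i * \<alpha>) * (a j * \<alpha>) * C i j) / 2))
      * complex_of_real (exp (- (\<Sum>i\<in>I. \<Sum>j\<in>I. (a i * \<beta>) * (a j * \<beta>) * D i j) / 2))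
      = complex_of_real (exp (- (\<Sum>i\<in>I. \<Sum>j\<in>I. a i * a j * (\<alpha>\<^sup>2 * C i j + \<beta>\<^sup>2 * D i j)) / 2))"
  proof -
    have "(\<Sum>i\<in>I. \<Sum>j\<in>I. a i * a j * (\<alpha>\<^sup>2 * C i j + \<beta>\<^sup>2 * D i j))
      = (\<Sum>i\<in>I. \<Sum>j\<in>I. (a i * \<alpha>) * (a j * \<alpha>) * C i j) + (\<Sum>i\<in>I. \<Sum>j\<in>I. (a i * \<beta>) * (a j * \<beta>) * D i j)"
      by (simp add: sum.distrib distrib_left power2_eq_square mult_ac)
    then show ?thesis
      unfolding of_real_mult[symmetric] exp_add[symmetric] by (simp add: add_divide_distrib)
  qed
  finally show "(\<integral>\<omega>. iexp (\<Sum>i\<in>I. a i * (\<alpha> * X i (fst \<omega>) + \<beta> * Y i (snd \<omega>))) \<partial>(M \<Otimes>\<^sub>M N))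
    = complex_of_real (exp (- (\<Sum>i\<in>I. \<Sum>j\<in>I. a i * a j * (\<alpha>\<^sup>2 * C i j + \<beta>\<^sup>2 * D i j)) / 2))" .
qed

lemma gaussian_vector_expectation_eq:
  fixes f :: "('i \<Rightarrow> real) \<Rightarrow> real"
  assumes "prob_space M" "prob_space N" "finite I" and X: "gaussian_vector M I C X" and Y: "gaussian_vector N I C Y"
    and f: "f \<in> borel_measurable (\<Pi>\<^sub>M i\<in>I. borel)"
  shows "(\<integral>\<omega>. f (\<lambda>i\<in>I. X i \<omega>) \<partial>M) = (\<integral>\<omega>. f (\<lambda>i\<in>I. Y i \<omega>) \<partial>N)"
proof -
  have [measurable]: "X i \<in> borel_measurable M" "Y i \<in> borel_measurable N" if "i \<in> I" for i
    using X Y that by (auto simp: gaussian_vector_def)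
  have "distr M (\<Pi>\<^sub>M i\<in>I. borel) (\<lambda>\<omega>. \<lambda>i\<in>I. X i \<omega>) = distr N (\<Pi>\<^sub>M i\<in>I. borel) (\<lambda>\<omega>. \<lambda>i\<in>I. Y i \<omega>)"
    using X Y by (intro Cramer_Wold assms) (auto simp: gaussian_vector_def)
  then have "(\<integral>x. f x \<partial>distr M (\<Pi>\<^sub>M i\<in>I. borel) (\<lambda>\<omega>. \<lambda>i\<in>I. X i \<omega>))
    = (\<integral>x. f x \<partial>distr N (\<Pi>\<^sub>M i\<in>I. borel) (\<lambda>\<omega>. \<lambda>i\<in>I. Y i \<omega>))" by simp
  then show ?thesis using f by (subst (asm) (1 2) integral_distr) auto
qed

section \<open>The log-sum-exp function\<close>

definition lse :: "'i set \<Rightarrow> ('i \<Rightarrow> real) \<Rightarrow> real" where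
  "lse I x = ln (\<Sum>i\<in>I. exp (x i))"

text \<open>The gradient of \<open>lse I\<close> at \<open>x\<close>; for finite non-empty
  \<open>I\<close> it is a probability vector on \<open>I\<close>.\<close>

definition softmax :: "'i set \<Rightarrow> ('i \<Rightarrow> real) \<Rightarrow> 'i \<Rightarrow> real" where
  "softmax I x i = exp (x i) / (\<Sum>k\<in>I. exp (x k))"

lemma sum_exp_pos: "finite I \<Longrightarrow> I \<noteq> {} \<Longrightarrow> 0 < (\<Sum>i\<in>I. exp (x i) :: real)"
  by (intro sum_pos) auto

lemma softmax_bounds:
  assumes "finite I" "I \<noteq> {}"
  shows "0 \<le> softmax I x i" "i \<in> I \<Longrightarrow> softmax I x i \<le> 1" "(\<Sum>i\<in>I. softmax I x i) = 1"
proof -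
  note p = sum_exp_pos[OF assms, of x]
  show "0 \<le> softmax I x i" using p by (simp add: softmax_def)
  show "softmax I x i \<le> 1" if "i \<in> I"
    using p member_le_sum[of i I "\<lambda>i. exp (x i)"] that assms by (simp add: softmax_def)
  show "(\<Sum>i\<in>I. softmax I x i) = 1" using p by (simp add: softmax_def flip: sum_divide_distrib)
qed

text \<open>The variance is half the mean squared difference of two independent draws. This turns
  the Hessian of \<open>lse\<close>, a variance under the softmax weights, into a combination of
  squared increments.\<close>

lemma weighted_variance:
  fixes p u :: "'i \<Rightarrow> real"
  assumes "(\<Sum>i\<in>I. p i) = 1"
  shows "(\<Sum>i\<in>I. p i * (u i)\<^sup>2) - (\<Sum>i\<in>I. p i * u i)\<^sup>2 = (\<Sum>i\<in>I. \<Sum>j\<in>I. p i * p j * (u i - u j)\<^sup>2) / 2"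
proof -
  have "(\<Sum>i\<in>I. \<Sum>j\<in>I. p i * p j * (u i - u j)\<^sup>2)
    = (\<Sum>i\<in>I. \<Sum>j\<in>I. (p i * (u i)\<^sup>2) * p j + p i * (p j * (u j)\<^sup>2) - 2 * ((p i * u i) * (p j * u j)))"
    by (intro sum.cong) (auto simp: power2_eq_square algebra_simps)
  also have "\<dots> = (\<Sum>i\<in>I. p i * (u i)\<^sup>2) * (\<Sum>j\<in>I. p j) + (\<Sum>i\<in>I. p i) * (\<Sum>j\<in>I. p j * (u j)\<^sup>2)
      - 2 * ((\<Sum>i\<in>I. p i * u i) * (\<Sum>j\<in>I. p j * u j))"
    by (simp only: sum_product) (simp only: sum.distrib sum_subtractf sum_distrib_left)
  finally show ?thesis using assms by (simp add: power2_eq_square)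
qed

text \<open>The remainder bound does not involve the base point \<open>z\<close>, so it survives
  integration over a random \<open>z\<close> that is independent of \<open>u\<close>.\<close>

lemma lse_taylor:
  fixes z u :: "'i \<Rightarrow> real"
  assumes I: "finite I" "I \<noteq> {}" and h: "0 < h"
  shows "\<bar>lse I (\<lambda>i. z i + h * u i) - lse I z - h * (\<Sum>i\<in>I. softmax I z i * u i)
           - h\<^sup>2 / 4 * (\<Sum>i\<in>I. \<Sum>j\<in>I. softmax I z i * softmax I z j * (u i - u j)\<^sup>2)\<bar>
         \<le> h ^ 3 * (\<Sum>i\<in>I. \<bar>u i\<bar>) ^ 3"
proof -
  \<comment> \<open>\<open>A k\<close> is the k-th derivative of the exponential sum
    \<open>A 0\<close> along the line z + s u. Hence \<open>a k s\<close> is the k-th moment of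
    \<open>u\<close> under the softmax weights at z + s u, and \<open>d 1\<close>,
    \<open>d 2\<close>, \<open>d 3\<close>, the derivatives of \<open>d 0 = ln (A 0)\<close>, are
    the first three cumulants.\<close>
  define A where "A k s = (\<Sum>i\<in>I. u i ^ k * exp (z i + s * u i))" for k :: nat and s
  define B where "B = (\<Sum>i\<in>I. \<bar>u i\<bar>)"
  define a where "a k s = A k s / A 0 s" for k s
  define d where "d = (\<lambda>(n::nat) s. if n = 0 then ln (A 0 s) else if n = 1 then a 1 s
      else if n = 2 then a 2 s - (a 1 s)\<^sup>2 else a 3 s - 3 * a 1 s * a 2 s + 2 * a 1 s ^ 3)"
  have dd: "d 0 = (\<lambda>s. ln (A 0 s))" "d 1 = a 1" "d 2 = (\<lambda>s. a 2 s - (a 1 s)\<^sup>2)"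
    "d 3 = (\<lambda>s. a 3 s - 3 * a 1 s * a 2 s + 2 * a 1 s ^ 3)"
    by (simp_all add: d_def fun_eq_iff)
  have A0: "0 < A 0 s" for s using sum_exp_pos[OF I] by (simp add: A_def)
  have dA: "(A k has_real_derivative A (Suc k) s) (at s)" for k s
    unfolding A_def by (auto intro!: derivative_eq_intros sum.cong simp: mult_ac)
  have da: "(a k has_real_derivative a (Suc k) s - a k s * a 1 s) (at s)" for k s
    unfolding a_def using A0[of s] dA[of k s] dA[of 0 s]
    by (auto intro!: derivative_eq_intros simp: field_simps)
  have d0: "(d 0 has_real_derivative d 1 s) (at s)" for s
    unfolding dd using A0[of s] dA[of 0 s] by (auto intro!: derivative_eq_intros simp: a_def)
  have d1: "(d 1 has_real_derivative d 2 s) (at s)" for s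
    unfolding dd using da[of 1 s] by (simp add: power2_eq_square numeral_2_eq_2)
  have d2: "(d 2 has_real_derivative d 3 s) (at s)" for s
    unfolding dd using DERIV_diff[OF da[of 2 s] DERIV_power[OF da[of 1 s], of 2]]
    by (simp add: numeral_2_eq_2 numeral_3_eq_3 algebra_simps power2_eq_square)
  have "\<exists>t>0. t < h \<and> d 0 h = (\<Sum>m<3. d m 0 / fact m * h ^ m) + d 3 t / fact 3 * h ^ 3"
  proof (rule Maclaurin[OF h])
    show "\<forall>m t. m < 3 \<and> 0 \<le> t \<and> t \<le> h \<longrightarrow> (d m has_real_derivative d (Suc m) t) (at t)"
      using d0 d1 d2 by (auto simp: less_Suc_eq numeral_3_eq_3 numeral_2_eq_2)
  qed auto
  then obtain t where t: "d 0 h = (\<Sum>m<3. d m 0 / fact m * h ^ m) + d 3 t / fact 3 * h ^ 3" by blast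
  have ab: "\<bar>a k s\<bar> \<le> B ^ k" for k s
  proof -
    have "\<bar>A k s\<bar> \<le> (\<Sum>i\<in>I. \<bar>u i ^ k * exp (z i + s * u i)\<bar>)" unfolding A_def by (rule sum_abs)
    also have "\<dots> \<le> (\<Sum>i\<in>I. B ^ k * exp (z i + s * u i))"
      unfolding B_def using I
      by (intro sum_mono) (auto simp: abs_mult power_abs intro!: mult_right_mono power_mono member_le_sum)
    also have "\<dots> = B ^ k * A 0 s" by (simp add: A_def sum_distrib_left)
    finally show ?thesis using A0[of s] by (simp add: a_def field_simps)
  qed
  have B0: "0 \<le> B" unfolding B_def by (simp add: sum_nonneg)
  \<comment> \<open>The coefficients 1 + 3 + 2 of the third cumulant add up to 3!, which cancels
    \<open>fact 3\<close> in the Taylor remainder.\<close>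
  have "\<bar>d 3 t\<bar> \<le> \<bar>a 3 t\<bar> + 3 * (\<bar>a 1 t\<bar> * \<bar>a 2 t\<bar>) + 2 * \<bar>a 1 t\<bar> ^ 3"
    unfolding d_def by (simp add: abs_mult[symmetric] power_abs[symmetric])
  also have "\<dots> \<le> B ^ 3 + 3 * (B ^ 1 * B ^ 2) + 2 * (B ^ 1) ^ 3"
    using ab[of 1 t] ab[of 2 t] ab[of 3 t] B0 by (intro add_mono mult_left_mono mult_mono power_mono) auto
  also have "\<dots> = 6 * B ^ 3" by (simp add: power2_eq_square power3_eq_cube)
  finally have "\<bar>d 3 t\<bar> \<le> 6 * B ^ 3" .
  then have R: "\<bar>d 3 t / fact 3 * h ^ 3\<bar> \<le> h ^ 3 * B ^ 3"
    using h mult_right_mono[of "\<bar>d 3 t\<bar>" "6 * B ^ 3" "h ^ 3"] by (simp add: abs_mult fact_numeral field_simps)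
  have a0: "a k 0 = (\<Sum>i\<in>I. softmax I z i * u i ^ k)" for k
    by (simp add: a_def A_def softmax_def sum_divide_distrib mult.commute)
  define S where "S = (\<Sum>i\<in>I. \<Sum>j\<in>I. softmax I z i * softmax I z j * (u i - u j)\<^sup>2)"
  have f1: "d 0 h = lse I (\<lambda>i. z i + h * u i)" "d 0 0 = lse I z"
    by (auto simp: d_def A_def lse_def)
  \<comment> \<open>This half and the 1/2 of the Taylor formula make the coefficient h^2 /
    4.\<close>
  have f2: "d 2 0 = S / 2"
    unfolding d_def S_def using weighted_variance[where I = I and p = "softmax I z" and u = u] softmax_bounds(3)[OF I]
    by (simp add: a0)
  have f3: "d 1 0 = (\<Sum>i\<in>I. softmax I z i * u i)" by (simp add: d_def a0)
  have f4: "(\<Sum>m<3. d m 0 / fact m * h ^ m) = d 0 0 + d 1 0 * h + d 2 0 / 2 * h\<^sup>2"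
    by (simp add: eval_nat_numeral)
  have "lse I (\<lambda>i. z i + h * u i) - lse I z - h * (\<Sum>i\<in>I. softmax I z i * u i)
      - h\<^sup>2 / 4 * S = d 3 t / fact 3 * h ^ 3"
    using t unfolding f1 f4 f2 f3 by simp
  with R show ?thesis unfolding B_def S_def by simp
qed

lemma lse_bounds:
  assumes I: "finite I" "I \<noteq> {}"
  shows "Max (x ` I) \<le> lse I x" "lse I x \<le> Max (x ` I) + ln (card I)"
proof -
  have "Max (x ` I) \<in> x ` I" using I by (intro Max_in) auto
  then obtain k where k: "k \<in> I" "Max (x ` I) = x k" by auto
  have "exp (x k) \<le> (\<Sum>i\<in>I. exp (x i))" using I k by (intro member_le_sum) auto
  then show "Max (x ` I) \<le> lse I x"
    unfolding lse_def k(2) using sum_exp_pos[OF I] by (subst ln_ge_iff) auto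
  have "(\<Sum>i\<in>I. exp (x i)) \<le> (\<Sum>i\<in>I. exp (Max (x ` I)))" using I by (intro sum_mono) auto
  then have "lse I x \<le> ln (card I * exp (Max (x ` I)))"
    unfolding lse_def using sum_exp_pos[OF I, of x] I by (subst ln_le_cancel_iff) (auto simp: card_gt_0_iff)
  also have "\<dots> = Max (x ` I) + ln (card I)" using I by (subst ln_mult) (auto simp: card_gt_0_iff)
  finally show "lse I x \<le> Max (x ` I) + ln (card I)" .
qed

lemma abs_Max_le_sum:
  fixes x :: "'i \<Rightarrow> real"
  assumes "finite I" "I \<noteq> {}"
  shows "\<bar>Max (x ` I)\<bar> \<le> (\<Sum>i\<in>I. \<bar>x i\<bar>)"
proof -
  have "Max (x ` I) \<in> x ` I" using assms by (intro Max_in) auto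
  then obtain k where "k \<in> I" "Max (x ` I) = x k" by auto
  then show ?thesis using assms member_le_sum[of k I "\<lambda>i. \<bar>x i\<bar>"] by auto
qed

lemma abs_lse_le:
  assumes I: "finite I" "I \<noteq> {}"
  shows "\<bar>lse I x\<bar> \<le> ln (card I) + (\<Sum>i\<in>I. \<bar>x i\<bar>)"
proof -
  have "0 \<le> ln (real (card I))" using I by (simp add: Suc_le_eq card_gt_0_iff)
  then show ?thesis using lse_bounds[OF I, of x] abs_Max_le_sum[OF I, of x] by linarith
qed

lemma integrable_lse:
  assumes "prob_space M" and I: "finite I" "I \<noteq> {}" and X: "\<And>i. i \<in> I \<Longrightarrow> integrable M (X i)"
  shows "integrable M (\<lambda>\<omega>. lse I (\<lambda>i. X i \<omega>))"
proof -
  interpret prob_space M by fact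
  have [measurable]: "X i \<in> borel_measurable M" if "i \<in> I" for i using X[OF that] by auto
  have "integrable M (\<lambda>\<omega>. ln (card I) + (\<Sum>i\<in>I. \<bar>X i \<omega>\<bar>))" using X by auto
  then show ?thesis
  proof (rule Bochner_Integration.integrable_bound)
    show "AE \<omega> in M. norm (lse I (\<lambda>i. X i \<omega>)) \<le> norm (ln (card I) + (\<Sum>i\<in>I. \<bar>X i \<omega>\<bar>))"
      using abs_lse_le[OF I] by (auto intro: order_trans[OF _ abs_ge_self])
  qed (simp add: lse_def)
qed

lemma integrable_Max:
  fixes X :: "'i \<Rightarrow> 'a \<Rightarrow> real"
  assumes I: "finite I" "I \<noteq> {}" and X: "\<And>i. i \<in> I \<Longrightarrow> integrable M (X i)"
  shows "integrable M (\<lambda>\<omega>. Max ((\<lambda>i. X i \<omega>) ` I))"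
proof -
  have [measurable]: "X i \<in> borel_measurable M" if "i \<in> I" for i using X[OF that] by auto
  have "integrable M (\<lambda>\<omega>. \<Sum>i\<in>I. \<bar>X i \<omega>\<bar>)" using X by auto
  then show ?thesis
  proof (rule Bochner_Integration.integrable_bound)
    show "(\<lambda>\<omega>. Max ((\<lambda>i. X i \<omega>) ` I)) \<in> borel_measurable M"
      using I by (intro borel_measurable_Max) auto
    show "AE \<omega> in M. norm (Max ((\<lambda>i. X i \<omega>) ` I)) \<le> norm (\<Sum>i\<in>I. \<bar>X i \<omega>\<bar>)"
      using abs_Max_le_sum[OF I] by (auto intro: order_trans[OF _ abs_ge_self])
  qed
qed

lemma pair_integral_fst_snd:
  fixes f :: "'a \<Rightarrow> real" and g :: "'b \<Rightarrow> real"
  assumes "prob_space M" "prob_space N"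
  shows "integrable M f \<Longrightarrow> integrable (M \<Otimes>\<^sub>M N) (\<lambda>\<omega>. f (fst \<omega>))"
    and "integrable M f \<Longrightarrow> (\<integral>\<omega>. f (fst \<omega>) \<partial>(M \<Otimes>\<^sub>M N)) = (\<integral>x. f x \<partial>M)"
    and "integrable N g \<Longrightarrow> integrable (M \<Otimes>\<^sub>M N) (\<lambda>\<omega>. g (snd \<omega>))"
    and "integrable N g \<Longrightarrow> (\<integral>\<omega>. g (snd \<omega>) \<partial>(M \<Otimes>\<^sub>M N)) = (\<integral>y. g y \<partial>N)"
proof -
  interpret M: prob_space M by fact
  interpret N: prob_space N by fact
  show "integrable M f \<Longrightarrow> integrable (M \<Otimes>\<^sub>M N) (\<lambda>\<omega>. f (fst \<omega>))"
    and "integrable M f \<Longrightarrow> (\<integral>\<omega>. f (fst \<omega>) \<partial>(M \<Otimes>\<^sub>M N)) = (\<integral>x. f x \<partial>M)"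
    using pair_integrable_mult[OF assms, of f "\<lambda>_. 1"] by (auto simp: N.prob_space)
  show "integrable N g \<Longrightarrow> integrable (M \<Otimes>\<^sub>M N) (\<lambda>\<omega>. g (snd \<omega>))"
    and "integrable N g \<Longrightarrow> (\<integral>\<omega>. g (snd \<omega>) \<partial>(M \<Otimes>\<^sub>M N)) = (\<integral>y. g y \<partial>N)"
    using pair_integrable_mult[OF assms, of "\<lambda>_. 1" g] by (auto simp: M.prob_space)
qed

lemma power3_sum_le:
  fixes x :: "'i \<Rightarrow> real"
  assumes I: "finite I" "I \<noteq> {}"
  shows "(\<Sum>i\<in>I. \<bar>x i\<bar>) ^ 3 \<le> real (card I) ^ 3 * (\<Sum>i\<in>I. \<bar>x i\<bar> ^ 3)"
proof -
  define m where "m = Max ((\<lambda>i. \<bar>x i\<bar>) ` I)"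
  have "m \<in> (\<lambda>i. \<bar>x i\<bar>) ` I" unfolding m_def using I by (intro Max_in) auto
  then obtain k where k: "k \<in> I" "m = \<bar>x k\<bar>" by auto
  have "(\<Sum>i\<in>I. \<bar>x i\<bar>) \<le> real (card I) * m"
    unfolding m_def using I by (intro sum_bounded_above) auto
  then have "(\<Sum>i\<in>I. \<bar>x i\<bar>) ^ 3 \<le> (real (card I) * m) ^ 3" by (intro power_mono) (auto simp: sum_nonneg)
  also have "\<dots> = real (card I) ^ 3 * \<bar>x k\<bar> ^ 3" by (simp add: power_mult_distrib k)
  also have "\<dots> \<le> real (card I) ^ 3 * (\<Sum>i\<in>I. \<bar>x i\<bar> ^ 3)"
    using I k by (intro mult_left_mono member_le_sum) auto
  finally show ?thesis .
qed

lemma centered_gaussian_process_abs_sum_power3: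
  assumes X: "centered_gaussian_process_cov M I C X" and I: "finite I" "I \<noteq> {}"
  shows "integrable M (\<lambda>\<omega>. (\<Sum>i\<in>I. \<bar>X i \<omega>\<bar>) ^ 3)"
proof -
  have [measurable]: "X i \<in> borel_measurable M" if "i \<in> I" for i
    using X that by (auto simp: centered_gaussian_process_cov_def gaussian_process_def)
  have "integrable M (\<lambda>\<omega>. real (card I) ^ 3 * (\<Sum>i\<in>I. \<bar>X i \<omega>\<bar> ^ 3))"
    using centered_gaussian_process_integrable(1)[OF X] by auto
  then show ?thesis
  proof (rule Bochner_Integration.integrable_bound)
    show "AE \<omega> in M. norm ((\<Sum>i\<in>I. \<bar>X i \<omega>\<bar>) ^ 3) \<le> norm (real (card I) ^ 3 * (\<Sum>i\<in>I. \<bar>X i \<omega>\<bar> ^ 3))"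
      using power3_sum_le[OF I] by (auto simp: sum_nonneg intro: order_trans[OF _ abs_ge_self])
  qed simp
qed

lemma centered_gaussian_process_increment:
  assumes X: "centered_gaussian_process_cov M I C X" and "i \<in> I" "j \<in> I"
  shows "integrable M (\<lambda>\<omega>. (X i \<omega> - X j \<omega>)\<^sup>2)"
    and "(\<integral>\<omega>. (X i \<omega> - X j \<omega>)\<^sup>2 \<partial>M) = C i i + C j j - 2 * C i j"
proof -
  have eq: "(X i \<omega> - X j \<omega>)\<^sup>2 = X i \<omega> * X i \<omega> + X j \<omega> * X j \<omega> - 2 * (X i \<omega> * X j \<omega>)" for \<omega>
    by (simp add: power2_eq_square algebra_simps)
  note int = centered_gaussian_process_integrable_mult[OF X]
  have c: "(\<integral>\<omega>. X k \<omega> * X l \<omega> \<partial>M) = C k l" if "k \<in> I" "l \<in> I" for k l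
    using X that by (auto simp: centered_gaussian_process_cov_def)
  show "integrable M (\<lambda>\<omega>. (X i \<omega> - X j \<omega>)\<^sup>2)"
    unfolding eq using int assms(2,3) by auto
  show "(\<integral>\<omega>. (X i \<omega> - X j \<omega>)\<^sup>2 \<partial>M) = C i i + C j j - 2 * C i j"
    unfolding eq using int c assms(2,3) by simp
qed

text \<open>\<open>Z\<close> and \<open>X\<close> live on different factors, so they are
  independent, and the softmax weights depend on \<open>Z\<close> alone. Therefore the first-order
  term integrates to 0, \<open>X\<close> being centered, and each second-order term factors into a
  mean of weights times an increment variance.\<close>

lemma lse_perturbation:
  fixes Z :: "'i \<Rightarrow> 'p \<Rightarrow> real"
  assumes P: "prob_space P" and M: "prob_space M" and I: "finite I" "I \<noteq> {}" and h: "0 < h"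
    and Z: "\<forall>i\<in>I. integrable P (Z i)"
    and X: "centered_gaussian_process_cov M I C X"
  shows "\<bar>(\<integral>\<omega>. lse I (\<lambda>i. Z i (fst \<omega>) + h * X i (snd \<omega>)) \<partial>(P \<Otimes>\<^sub>M M)) - (\<integral>\<omega>. lse I (\<lambda>i. Z i \<omega>) \<partial>P)
     - h\<^sup>2 / 4 * (\<Sum>i\<in>I. \<Sum>j\<in>I. (\<integral>\<omega>. softmax I (\<lambda>i. Z i \<omega>) i * softmax I (\<lambda>i. Z i \<omega>) j \<partial>P) * (C i i + C j j - 2 * C i j))\<bar>
     \<le> h ^ 3 * (\<integral>\<omega>. (\<Sum>i\<in>I. \<bar>X i \<omega>\<bar>) ^ 3 \<partial>M)"
proof -
  interpret P: prob_space P by fact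
  interpret M: prob_space M by fact
  have [measurable]: "X i \<in> borel_measurable M" "Z i \<in> borel_measurable P" if "i \<in> I" for i
    using X Z that by (auto simp: centered_gaussian_process_cov_def gaussian_process_def)
  define p where "p i \<omega> = softmax I (\<lambda>i. Z i \<omega>) i" for i \<omega>
  have p[measurable]: "p i \<in> borel_measurable P" if "i \<in> I" for i
    using that unfolding p_def softmax_def by measurable
  have p01: "\<bar>p i \<omega>\<bar> \<le> 1" if "i \<in> I" for i \<omega>
    using softmax_bounds[OF I] that by (auto simp: p_def)
  have ip: "integrable P (p i)" if "i \<in> I" for i
    by (rule P.integrable_const_bound[where B=1]) (use p01 p that in auto)
  have ipp: "integrable P (\<lambda>\<omega>. p i \<omega> * p j \<omega>)" if "i \<in> I" "j \<in> I" for i j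
    by (rule P.integrable_const_bound[where B=1]) (use p01 that in \<open>auto simp: abs_mult intro!: mult_le_one\<close>)
  note iX = centered_gaussian_process_integrable(2)[OF X]
  note inc = centered_gaussian_process_increment[OF X]
  define L where "L \<omega> = lse I (\<lambda>i. Z i (fst \<omega>) + h * X i (snd \<omega>))" for \<omega>
  define F1 where "F1 \<omega> = (\<Sum>i\<in>I. p i (fst \<omega>) * X i (snd \<omega>))" for \<omega>
  define F2 where "F2 \<omega> = (\<Sum>i\<in>I. \<Sum>j\<in>I. (p i (fst \<omega>) * p j (fst \<omega>)) * (X i (snd \<omega>) - X j (snd \<omega>))\<^sup>2)" for \<omega>
  define Q where "Q = P \<Otimes>\<^sub>M M"
  note pm = pair_integrable_mult[OF P M]
  have iL0: "integrable Q (\<lambda>\<omega>. lse I (\<lambda>i. Z i (fst \<omega>)))"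
    and eL0: "(\<integral>\<omega>. lse I (\<lambda>i. Z i (fst \<omega>)) \<partial>Q) = (\<integral>\<omega>. lse I (\<lambda>i. Z i \<omega>) \<partial>P)"
    unfolding Q_def using Z by (auto intro!: pair_integral_fst_snd(1,2)[OF P M] integrable_lse[OF P I])
  have iL: "integrable Q L"
    unfolding L_def Q_def using Z iX
    by (intro integrable_lse prob_space_pair P M I Bochner_Integration.integrable_add integrable_mult_right pair_integral_fst_snd) auto
  have iF1: "integrable Q F1" and eF1: "integral\<^sup>L Q F1 = 0"
  proof -
    have 1: "integrable Q (\<lambda>\<omega>. p i (fst \<omega>) * X i (snd \<omega>))"
      and 2: "(\<integral>\<omega>. p i (fst \<omega>) * X i (snd \<omega>) \<partial>Q) = 0" if "i \<in> I" for i
      using pm[OF ip[OF that] iX[OF that]] X that by (simp_all add: Q_def centered_gaussian_process_cov_def)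
    show "integrable Q F1" unfolding F1_def using 1 by (intro Bochner_Integration.integrable_sum) auto
    show "integral\<^sup>L Q F1 = 0"
      unfolding F1_def using 1 2 by (simp add: Bochner_Integration.integral_sum)
  qed
  have iF2: "integrable Q F2" and eF2: "integral\<^sup>L Q F2 = (\<Sum>i\<in>I. \<Sum>j\<in>I. (\<integral>\<omega>. p i \<omega> * p j \<omega> \<partial>P) * (C i i + C j j - 2 * C i j))"
  proof -
    have 1: "integrable Q (\<lambda>\<omega>. (p i (fst \<omega>) * p j (fst \<omega>)) * (X i (snd \<omega>) - X j (snd \<omega>))\<^sup>2)"
      and 2: "(\<integral>\<omega>. (p i (fst \<omega>) * p j (fst \<omega>)) * (X i (snd \<omega>) - X j (snd \<omega>))\<^sup>2 \<partial>Q) = (\<integral>\<omega>. p i \<omega> * p j \<omega> \<partial>P) * (C i i + C j j - 2 * C i j)"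
      if "i \<in> I" "j \<in> I" for i j
      using pm[OF ipp[OF that] inc(1)[OF that]] inc(2)[OF that] by (simp_all add: Q_def)
    show "integrable Q F2" unfolding F2_def using 1 by (intro Bochner_Integration.integrable_sum) auto
    show "integral\<^sup>L Q F2 = (\<Sum>i\<in>I. \<Sum>j\<in>I. (\<integral>\<omega>. p i \<omega> * p j \<omega> \<partial>P) * (C i i + C j j - 2 * C i j))"
      unfolding F2_def using 1 2 by (simp add: Bochner_Integration.integral_sum)
  qed
  note i3 = centered_gaussian_process_abs_sum_power3[OF X I]
  have iR: "integrable Q (\<lambda>\<omega>. L \<omega> - lse I (\<lambda>i. Z i (fst \<omega>)) - h * F1 \<omega> - h\<^sup>2 / 4 * F2 \<omega>)"
    using iL iL0 iF1 iF2 by (intro Bochner_Integration.integrable_diff integrable_mult_right)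
  have "integral\<^sup>L Q L - (\<integral>\<omega>. lse I (\<lambda>i. Z i \<omega>) \<partial>P) - h\<^sup>2 / 4 * integral\<^sup>L Q F2
     = (\<integral>\<omega>. L \<omega> - lse I (\<lambda>i. Z i (fst \<omega>)) - h * F1 \<omega> - h\<^sup>2 / 4 * F2 \<omega> \<partial>Q)"
    using iL iL0 iF1 iF2 eL0 eF1 by simp
  also have "\<bar>\<dots>\<bar> \<le> (\<integral>\<omega>. \<bar>L \<omega> - lse I (\<lambda>i. Z i (fst \<omega>)) - h * F1 \<omega> - h\<^sup>2 / 4 * F2 \<omega>\<bar> \<partial>Q)"
    by (rule integral_abs_bound)
  also have "\<dots> \<le> (\<integral>\<omega>. h ^ 3 * (\<Sum>i\<in>I. \<bar>X i (snd \<omega>)\<bar>) ^ 3 \<partial>Q)"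
  proof (rule integral_mono)
    show "integrable Q (\<lambda>\<omega>. h ^ 3 * (\<Sum>i\<in>I. \<bar>X i (snd \<omega>)\<bar>) ^ 3)"
      unfolding Q_def using pair_integral_fst_snd(3)[OF P M i3] by simp
  qed (use iR lse_taylor[OF I h] in \<open>auto simp: L_def F1_def F2_def p_def\<close>)
  also have "\<dots> = h ^ 3 * (\<integral>\<omega>. (\<Sum>i\<in>I. \<bar>X i \<omega>\<bar>) ^ 3 \<partial>M)"
    unfolding Q_def using pair_integral_fst_snd(4)[OF P M i3] by simp
  finally show ?thesis unfolding eF2 unfolding Q_def L_def p_def .
qed

section \<open>The Sudakov-Fernique inequality\<close>

lemma gaussian_vector_lse_eq:
  assumes "prob_space M" "prob_space N" "finite I" and X: "gaussian_vector M I C X" and Y: "gaussian_vector N I D Y"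
    and CD: "\<And>i j. C i j = D i j"
  shows "(\<integral>\<omega>. lse I (\<lambda>i. m i + X i \<omega>) \<partial>M) = (\<integral>\<omega>. lse I (\<lambda>i. m i + Y i \<omega>) \<partial>N)"
proof -
  have "C = D" using CD by (simp add: fun_eq_iff)
  have "(\<lambda>x. lse I (\<lambda>i. m i + x i)) \<in> borel_measurable (\<Pi>\<^sub>M i\<in>I. borel)"
    unfolding lse_def by measurable
  from gaussian_vector_expectation_eq[OF assms(1-3) X Y[folded \<open>C = D\<close>] this]
  show ?thesis by (simp add: lse_def)
qed

text \<open>The unperturbed term and the coefficients \<open>q i j \<ge> 0\<close> depend only on
  \<open>Z\<close>, so they are the same for \<open>X\<close> and \<open>Y\<close>. Only the
  increment variances differ, up to the two third-order errors.\<close>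

lemma lse_expectation_swap:
  fixes Z :: "'i \<Rightarrow> 'p \<Rightarrow> real"
  assumes P: "prob_space P" and M: "prob_space M" and N: "prob_space N"
    and I: "finite I" "I \<noteq> {}" and h: "0 < h"
    and Z: "\<forall>i\<in>I. integrable P (Z i)"
    and X: "centered_gaussian_process_cov M I C X" and Y: "centered_gaussian_process_cov N I D Y"
    and inc: "\<forall>i\<in>I. \<forall>j\<in>I. D i i + D j j - 2 * D i j \<le> C i i + C j j - 2 * C i j"
  shows "(\<integral>\<omega>. lse I (\<lambda>i. Z i (fst \<omega>) + h * Y i (snd \<omega>)) \<partial>(P \<Otimes>\<^sub>M N))
    \<le> (\<integral>\<omega>. lse I (\<lambda>i. Z i (fst \<omega>) + h * X i (snd \<omega>)) \<partial>(P \<Otimes>\<^sub>M M))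
      + h ^ 3 * ((\<integral>\<omega>. (\<Sum>i\<in>I. \<bar>X i \<omega>\<bar>) ^ 3 \<partial>M) + (\<integral>\<omega>. (\<Sum>i\<in>I. \<bar>Y i \<omega>\<bar>) ^ 3 \<partial>N))"
proof -
  define q where "q i j = (\<integral>\<omega>. softmax I (\<lambda>i. Z i \<omega>) i * softmax I (\<lambda>i. Z i \<omega>) j \<partial>P)" for i j
  have "0 \<le> q i j" for i j
    unfolding q_def using softmax_bounds(1)[OF I] by (intro Bochner_Integration.integral_nonneg) auto
  then have "h\<^sup>2 / 4 * (\<Sum>i\<in>I. \<Sum>j\<in>I. q i j * (D i i + D j j - 2 * D i j))
    \<le> h\<^sup>2 / 4 * (\<Sum>i\<in>I. \<Sum>j\<in>I. q i j * (C i i + C j j - 2 * C i j))"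
    using inc by (intro mult_left_mono sum_mono) auto
  then show ?thesis
    using lse_perturbation[OF P M I h Z X] lse_perturbation[OF P N I h Z Y]
    unfolding q_def[symmetric] distrib_left by linarith
qed

text \<open>Lindeberg's replacement argument: along the path \<open>sqrt (k/n) X + sqrt (1 - k/n) Y\<close> each
  step swaps an independent copy of \<open>Y / sqrt n\<close> for one of \<open>X / sqrt n\<close>.\<close>

lemma lse_expectation_le:
  fixes m :: "'i \<Rightarrow> real"
  assumes M: "prob_space M" and N: "prob_space N" and I: "finite I" "I \<noteq> {}"
    and X: "centered_gaussian_process_cov M I C X" and Y: "centered_gaussian_process_cov N I D Y"
    and inc: "\<And>i j. i \<in> I \<Longrightarrow> j \<in> I \<Longrightarrow> D i i + D j j - 2 * D i j \<le> C i i + C j j - 2 * C i j"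
  shows "(\<integral>\<omega>. lse I (\<lambda>i. m i + Y i \<omega>) \<partial>N) \<le> (\<integral>\<omega>. lse I (\<lambda>i. m i + X i \<omega>) \<partial>M)"
proof -
  define K where "K = (\<integral>\<omega>. (\<Sum>i\<in>I. \<bar>X i \<omega>\<bar>) ^ 3 \<partial>M) + (\<integral>\<omega>. (\<Sum>i\<in>I. \<bar>Y i \<omega>\<bar>) ^ 3 \<partial>N)"
  let ?EX = "\<integral>\<omega>. lse I (\<lambda>i. m i + X i \<omega>) \<partial>M" and ?EY = "\<integral>\<omega>. lse I (\<lambda>i. m i + Y i \<omega>) \<partial>N"
  note MN = prob_space_pair[OF M N]
  note gX = gaussian_vector_process[OF X I(1)] and gY = gaussian_vector_process[OF Y I(1)]
  have "?EY \<le> ?EX + K * inverse (sqrt (real (Suc n')))" for n'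
  proof -
    define n where "n = Suc n'"
    define h where "h = inverse (sqrt (real n))"
    have n: "real n > 0" and h: "h > 0" and h2: "h\<^sup>2 = 1 / real n"
      by (simp_all add: n_def h_def inverse_eq_divide power_divide)
    define U where "U a b i \<omega> = sqrt a * X i (fst \<omega>) + sqrt b * Y i (snd \<omega>)" for a b i \<omega>
    define G where "G k = (\<integral>\<omega>. lse I (\<lambda>i. m i + U (real k / n) (real (n - k) / n) i \<omega>) \<partial>(M \<Otimes>\<^sub>M N))" for k :: nat
    have gU: "gaussian_vector (M \<Otimes>\<^sub>M N) I (\<lambda>i j. (sqrt a)\<^sup>2 * C i j + (sqrt b)\<^sup>2 * D i j) (U a b)" for a b
      unfolding U_def by (rule gaussian_vector_pair[OF M N gX gY])
    have iU: "\<forall>i\<in>I. integrable (M \<Otimes>\<^sub>M N) (\<lambda>\<omega>. m i + U a b i \<omega>)" for a b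
    proof
      fix i assume that: "i \<in> I"
      interpret MN: prob_space "M \<Otimes>\<^sub>M N" by fact
      have "integrable (M \<Otimes>\<^sub>M N) (\<lambda>\<omega>. X i (fst \<omega>))" "integrable (M \<Otimes>\<^sub>M N) (\<lambda>\<omega>. Y i (snd \<omega>))"
        by (rule pair_integral_fst_snd(1,3)[OF M N] centered_gaussian_process_integrable(2)[OF X that]
            centered_gaussian_process_integrable(2)[OF Y that])+
      then show "integrable (M \<Otimes>\<^sub>M N) (\<lambda>\<omega>. m i + U a b i \<omega>)" unfolding U_def by simp
    qed
    have step: "G k \<le> G (Suc k) + h ^ 3 * K" if "k < n" for k
    proof -
      \<comment> \<open>\<open>U a b\<close> is the part common to \<open>G k\<close> and
        \<open>G (Suc k)\<close>; the missing share 1/n goes to \<open>Y\<close> in the former and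
        to \<open>X\<close> in the latter.\<close>
      define a b where "a = real k / n" and "b = real (n - Suc k) / n"
      have ab: "0 \<le> a" "0 \<le> b" "0 \<le> 1 / real n" by (auto simp: a_def b_def)
      have "real (n - k) / n = b + 1 / n" "real (Suc k) / n = a + 1 / n"
        using that by (auto simp: a_def b_def add_divide_distrib[symmetric] of_nat_diff)
      then have Gk: "G k = (\<integral>\<omega>. lse I (\<lambda>i. m i + U a (b + 1 / n) i \<omega>) \<partial>(M \<Otimes>\<^sub>M N))"
        and GSk: "G (Suc k) = (\<integral>\<omega>. lse I (\<lambda>i. m i + U (a + 1 / n) b i \<omega>) \<partial>(M \<Otimes>\<^sub>M N))"
        by (simp_all only: G_def a_def b_def)
      \<comment> \<open>An independent copy of \<open>X\<close> on a third factor, scaled by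
        \<open>h\<close>, adds the covariance \<open>C / n\<close>, which is what raising
        \<open>a\<close> to \<open>a + 1 / n\<close> does. Equal covariances give equal laws. The
        factor 1 fits the shape of \<open>gaussian_vector_pair\<close>.\<close>
      have "G (Suc k) = (\<integral>\<omega>. lse I (\<lambda>i. m i + (1 * U a b i (fst \<omega>) + h * X i (snd \<omega>))) \<partial>((M \<Otimes>\<^sub>M N) \<Otimes>\<^sub>M M))"
        unfolding GSk
        by (rule gaussian_vector_lse_eq[OF MN prob_space_pair[OF MN M] I(1) gU gaussian_vector_pair[OF MN M gU gX]])
          (use ab in \<open>simp only: h2 real_sqrt_pow2 add_nonneg_nonneg, simp add: distrib_right\<close>)
      moreover have "G k = (\<integral>\<omega>. lse I (\<lambda>i. m i + (1 * U a b i (fst \<omega>) + h * Y i (snd \<omega>))) \<partial>((M \<Otimes>\<^sub>M N) \<Otimes>\<^sub>M N))"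
        unfolding Gk
        by (rule gaussian_vector_lse_eq[OF MN prob_space_pair[OF MN N] I(1) gU gaussian_vector_pair[OF MN N gU gY]])
          (use ab in \<open>simp only: h2 real_sqrt_pow2 add_nonneg_nonneg, simp add: distrib_right\<close>)
      ultimately show ?thesis
        using lse_expectation_swap[OF MN M N I h iU X Y, of a b] inc by (simp add: K_def add.assoc)
    qed
    have "G 0 \<le> G k + real k * (h ^ 3 * K)" if "k \<le> n" for k
      using that
    proof (induction k)
      case (Suc k)
      then show ?case using step[of k] by (simp add: algebra_simps)
    qed simp
    from this[of n] have "G 0 \<le> G n + real n * (h ^ 3 * K)" by simp
    \<comment> \<open>Since \<open>n * h\<^sup>2 = 1\<close>, the accumulated error is of order
      \<open>h\<close> and vanishes in the limit; an error of order \<open>h\<^sup>2\<close> per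
      step would not.\<close>
    also have "real n * (h ^ 3 * K) = K * h"
      using n by (simp add: power3_eq_cube h2[unfolded power2_eq_square] mult.assoc[symmetric])
    also have "G 0 = ?EY"
      unfolding G_def
      by (rule gaussian_vector_lse_eq[OF MN N I(1) gU gY]) (use n in simp)
    also have "G n = ?EX"
      unfolding G_def
      by (rule gaussian_vector_lse_eq[OF MN M I(1) gU gX]) (use n in simp)
    finally show ?thesis by (simp add: h_def n_def)
  qed
  moreover have "(\<lambda>n. inverse (sqrt (real n))) \<longlonglongrightarrow> 0"
    by (rule tendsto_inverse_0_at_top[OF filterlim_compose[OF sqrt_at_top filterlim_real_sequentially]])
  then have "(\<lambda>n. ?EX + K * inverse (sqrt (real (Suc n)))) \<longlonglongrightarrow> ?EX + K * 0"
    by (intro tendsto_add tendsto_mult tendsto_const LIMSEQ_Suc[where f = "\<lambda>n. inverse (sqrt (real n))"])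
  ultimately show ?thesis by (intro LIMSEQ_le_const[of _ "?EX" "?EY"]) auto
qed

lemma centered_gaussian_process_scale:
  assumes X: "centered_gaussian_process_cov M I C X"
    and Y: "\<And>i \<omega>. i \<in> I \<Longrightarrow> \<omega> \<in> space M \<Longrightarrow> Y i \<omega> = c * X i \<omega>"
  shows "centered_gaussian_process_cov M I (\<lambda>i j. c\<^sup>2 * C i j) Y"
  unfolding centered_gaussian_process_cov_def gaussian_process_def
proof (intro conjI ballI allI impI)
  note X = X[unfolded centered_gaussian_process_cov_def gaussian_process_def]
  show "Y i \<in> borel_measurable M" if "i \<in> I" for i
  proof -
    have "X i \<in> borel_measurable M" using X that by auto
    then have "(\<lambda>\<omega>. c * X i \<omega>) \<in> borel_measurable M" by measurable
    then show ?thesis using Y[OF that] by (simp cong: measurable_cong)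
  qed
  show "(\<integral>\<omega>. Y i \<omega> \<partial>M) = 0" if "i \<in> I" for i
    using X Y[OF that] that by (simp cong: Bochner_Integration.integral_cong)
  show "(\<integral>\<omega>. Y i \<omega> * Y j \<omega> \<partial>M) = c\<^sup>2 * C i j" if "i \<in> I" "j \<in> I" for i j
  proof -
    have "(\<integral>\<omega>. Y i \<omega> * Y j \<omega> \<partial>M) = (\<integral>\<omega>. c\<^sup>2 * (X i \<omega> * X j \<omega>) \<partial>M)"
      using Y that by (intro Bochner_Integration.integral_cong) (auto simp: power2_eq_square)
    then show ?thesis using X that by simp
  qed
  show "\<exists>\<mu> \<sigma>. 0 \<le> \<sigma> \<and> distr M borel (\<lambda>\<omega>. \<Sum>j\<in>J. a j * Y j \<omega>) = normal_law \<mu> \<sigma>"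
    if "finite J \<and> J \<subseteq> I" for J a
  proof -
    have "distr M borel (\<lambda>\<omega>. \<Sum>j\<in>J. a j * Y j \<omega>) = distr M borel (\<lambda>\<omega>. \<Sum>j\<in>J. (a j * c) * X j \<omega>)"
      using Y that by (intro distr_cong) (auto intro!: sum.cong)
    then show ?thesis using X that by presburger
  qed
qed

text \<open>\<tau> may take a value several times, as when a sampling sequence repeats a time or
  itself visits 0. The coefficients over each fibre of \<tau> are added, which leaves a combination
  over distinct times.\<close>

lemma centered_gaussian_process_reindex:
  assumes X: "centered_gaussian_process_cov M T C X" and \<tau>: "\<tau> ` I \<subseteq> T"
  shows "centered_gaussian_process_cov M I (\<lambda>i j. C (\<tau> i) (\<tau> j)) (\<lambda>i. X (\<tau> i))"
  unfolding centered_gaussian_process_cov_def gaussian_process_def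
proof (intro conjI ballI allI impI)
  note X = X[unfolded centered_gaussian_process_cov_def gaussian_process_def]
  show "\<exists>\<mu> \<sigma>. 0 \<le> \<sigma> \<and> distr M borel (\<lambda>\<omega>. \<Sum>j\<in>J. a j * X (\<tau> j) \<omega>) = normal_law \<mu> \<sigma>"
    if J: "finite J \<and> J \<subseteq> I" for J a
  proof -
    have "(\<Sum>j\<in>J. a j * X (\<tau> j) \<omega>) = (\<Sum>t\<in>\<tau> ` J. (\<Sum>j\<in>{j\<in>J. \<tau> j = t}. a j) * X t \<omega>)" for \<omega>
      using J by (subst sum.image_gen[of J _ \<tau>]) (auto simp: sum_distrib_right intro!: sum.cong)
    moreover have "finite (\<tau> ` J) \<and> \<tau> ` J \<subseteq> T" using J \<tau> by auto
    ultimately show ?thesis using X by presburger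
  qed
  have \<tau>: "\<tau> i \<in> T" if "i \<in> I" for i using \<tau> that by blast
  show "X (\<tau> i) \<in> borel_measurable M" if "i \<in> I" for i using X \<tau>[OF that] by blast
  show "(\<integral>\<omega>. X (\<tau> i) \<omega> \<partial>M) = 0" if "i \<in> I" for i using X \<tau>[OF that] by blast
  show "(\<integral>\<omega>. X (\<tau> i) \<omega> * X (\<tau> j) \<omega> \<partial>M) = C (\<tau> i) (\<tau> j)" if "i \<in> I" "j \<in> I" for i j
    using X \<tau>[OF that(1)] \<tau>[OF that(2)] by blast
qed

text \<open>The smooth maximum of \<open>b * x\<close> lies between \<open>b * Max x\<close> and
  \<open>b * Max x + ln (card I)\<close>. Scaling vectors and means by \<open>b\<close> and dividing
  the comparison by \<open>b\<close> leaves the error \<open>ln (card I) / b\<close>, which vanishes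
  as \<open>b\<close> grows.\<close>

theorem Sudakov_Fernique:
  fixes m :: "'i \<Rightarrow> real"
  assumes M: "prob_space M" and N: "prob_space N" and I: "finite I" "I \<noteq> {}"
    and X: "centered_gaussian_process_cov M I C X" and Y: "centered_gaussian_process_cov N I D Y"
    and inc: "\<And>i j. i \<in> I \<Longrightarrow> j \<in> I \<Longrightarrow> D i i + D j j - 2 * D i j \<le> C i i + C j j - 2 * C i j"
  shows "(\<integral>\<omega>. Max ((\<lambda>i. Y i \<omega> + m i) ` I) \<partial>N) \<le> (\<integral>\<omega>. Max ((\<lambda>i. X i \<omega> + m i) ` I) \<partial>M)"
proof -
  let ?MX = "\<lambda>\<omega>. Max ((\<lambda>i. X i \<omega> + m i) ` I)" and ?MY = "\<lambda>\<omega>. Max ((\<lambda>i. Y i \<omega> + m i) ` I)"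
  interpret M: prob_space M by fact
  interpret N: prob_space N by fact
  have iX: "integrable M (\<lambda>\<omega>. b * X i \<omega> + c)" and iY: "integrable N (\<lambda>\<omega>. b * Y i \<omega> + c)" if "i \<in> I" for i b c
    using centered_gaussian_process_integrable(2)[OF X that] centered_gaussian_process_integrable(2)[OF Y that] by auto
  have iMX: "integrable M ?MX" and iMY: "integrable N ?MY"
    using iX[of _ 1] iY[of _ 1] I by (auto intro!: integrable_Max)
  have "integral\<^sup>L N ?MY \<le> integral\<^sup>L M ?MX + ln (card I) * inverse (real (Suc n))" for n
  proof -
    define b where "b = real (Suc n)"
    have b: "b > 0" by (simp add: b_def)
    have Max_b: "b * Max (f ` I) = Max ((\<lambda>i. b * f i) ` I)" for f
      using I b by (subst mono_Max_commute[of "(*) b"]) (auto simp: image_image mono_def intro: mult_left_mono)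
    have bX: "centered_gaussian_process_cov M I (\<lambda>i j. b\<^sup>2 * C i j) (\<lambda>i \<omega>. b * X i \<omega>)"
      and bY: "centered_gaussian_process_cov N I (\<lambda>i j. b\<^sup>2 * D i j) (\<lambda>i \<omega>. b * Y i \<omega>)"
      using centered_gaussian_process_scale[OF X] centered_gaussian_process_scale[OF Y] by auto
    have ilX: "integrable M (\<lambda>\<omega>. lse I (\<lambda>i. b * m i + b * X i \<omega>))"
      and ilY: "integrable N (\<lambda>\<omega>. lse I (\<lambda>i. b * m i + b * Y i \<omega>))"
      using iX iY by (auto intro!: integrable_lse M N I simp: add.commute)
    have "b * integral\<^sup>L N ?MY = (\<integral>\<omega>. b * ?MY \<omega> \<partial>N)" by simp
    also have "\<dots> \<le> (\<integral>\<omega>. lse I (\<lambda>i. b * m i + b * Y i \<omega>) \<partial>N)"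
    proof (rule integral_mono)
      show "b * ?MY \<omega> \<le> lse I (\<lambda>i. b * m i + b * Y i \<omega>)" for \<omega>
        using lse_bounds(1)[OF I, of "\<lambda>i. b * m i + b * Y i \<omega>"] unfolding Max_b
        by (simp add: distrib_left add.commute)
    qed (use iMY ilY in \<open>auto simp: M.emeasure_eq_measure\<close>)
    also have "\<dots> \<le> (\<integral>\<omega>. lse I (\<lambda>i. b * m i + b * X i \<omega>) \<partial>M)"
    proof (rule lse_expectation_le[OF M N I bX bY])
      fix i j assume "i \<in> I" "j \<in> I"
      then have "b\<^sup>2 * (D i i + D j j - 2 * D i j) \<le> b\<^sup>2 * (C i i + C j j - 2 * C i j)"
        using inc by (intro mult_left_mono) auto
      then show "b\<^sup>2 * D i i + b\<^sup>2 * D j j - 2 * (b\<^sup>2 * D i j) \<le> b\<^sup>2 * C i i + b\<^sup>2 * C j j - 2 * (b\<^sup>2 * C i j)"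
        by (simp add: algebra_simps)
    qed
    also have "\<dots> \<le> (\<integral>\<omega>. b * ?MX \<omega> + ln (card I) \<partial>M)"
    proof (rule integral_mono)
      show "lse I (\<lambda>i. b * m i + b * X i \<omega>) \<le> b * ?MX \<omega> + ln (card I)" for \<omega>
        using lse_bounds(2)[OF I, of "\<lambda>i. b * m i + b * X i \<omega>"] unfolding Max_b
        by (simp add: distrib_left add.commute)
    qed (use iMX ilX in \<open>auto simp: M.emeasure_eq_measure\<close>)
    also have "\<dots> = b * integral\<^sup>L M ?MX + ln (card I)" using iMX by (simp add: M.prob_space)
    finally show ?thesis using b unfolding b_def[symmetric] by (simp add: field_simps)
  qed
  moreover have "(\<lambda>n. integral\<^sup>L M ?MX + ln (card I) * inverse (real (Suc n))) \<longlonglongrightarrow> integral\<^sup>L M ?MX + ln (card I) * 0"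
    by (intro tendsto_intros LIMSEQ_inverse_real_of_nat)
  ultimately show ?thesis by (intro LIMSEQ_le_const[of _ "integral\<^sup>L M ?MX"]) auto
qed

section \<open>The increasing convex order\<close>

text \<open>On \<open>[a, \<infinity>)\<close>, a non-decreasing convex \<open>g\<close> lies, up to a shift of its argument by \<open>2 h\<close> and a
  constant, below the piecewise linear function whose slope on the cell \<open>[x j, x (j + 1)]\<close> of the grid
  \<open>x j = a + j h\<close> is the difference quotient of \<open>g\<close> over the preceding cell. That function is a
  non-negative combination of the functions \<open>\<lambda>y. max (y - x j) 0\<close> plus a constant.\<close>

lemma convex_piecewise_linear:
  fixes g :: "real \<Rightarrow> real"
  assumes g: "mono g" "convex_on UNIV g" and h: "0 < h"
  obtains e x :: "nat \<Rightarrow> real" where "\<And>j. 0 \<le> e j"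
    and "\<And>y. a \<le> y \<Longrightarrow> ennreal (g (y - 2 * h) - g a) \<le> (\<Sum>j. ennreal (e j) * ennreal (y - x j))"
    and "\<And>y. a \<le> y \<Longrightarrow> (\<Sum>j. ennreal (e j) * ennreal (y - x j)) \<le> ennreal (g y - g a) + ennreal (g a - g (a - h))"
proof -
  define x where "x j = a + real j * h" for j
  define d where "d j = (g (x j) - g (x j - h)) / h" for j
  define e where "e j = (case j of 0 \<Rightarrow> d 0 | Suc i \<Rightarrow> d (Suc i) - d i)" for j
  have xS: "x (Suc j) = x j + h" for j by (simp add: x_def algebra_simps)
  have g_mono: "g u \<le> g v" if "u \<le> v" for u v using monoD[OF g(1) that] .
  have d0: "0 \<le> d j" for j using g_mono[of "x j - h" "x j"] h by (simp add: d_def)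
  have "d j \<le> d (Suc j)" for j
  proof -
    have "g ((1 - 1/2) *\<^sub>R (x j - h) + (1/2) *\<^sub>R (x j + h)) \<le> (1 - 1/2) * g (x j - h) + (1/2) * g (x j + h)"
      by (rule convex_onD[OF g(2)]) auto
    then have "g (x j) - g (x j - h) \<le> g (x j + h) - g (x j)" by (simp add: field_simps)
    then show ?thesis using h by (simp add: d_def xS divide_right_mono)
  qed
  then have e0: "0 \<le> e j" for j using d0 by (cases j) (auto simp: e_def)
  \<comment> \<open>Summing the slope changes \<open>e j\<close> up to \<open>k\<close> gives slope
    \<open>d k\<close> on the cell that begins at \<open>x k\<close>; the value at
    \<open>x k\<close> telescopes because \<open>d j * h\<close> is the increase of \<open>g\<close>
    over the preceding cell.\<close>
  have part: "(\<Sum>j\<le>k. e j * (y - x j)) = g (x k - h) - g (a - h) + d k * (y - x k)" for k y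
  proof (induction k)
    case 0
    then show ?case by (simp add: e_def x_def)
  next
    case (Suc k)
    have "d k * h = g (x k) - g (x k - h)" using h by (simp add: d_def)
    then show ?case using Suc by (simp add: e_def xS algebra_simps)
  qed
  have val: "\<exists>k. (\<Sum>j. ennreal (e j) * ennreal (y - x j)) = ennreal (g (x k - h) - g (a - h) + d k * (y - x k))
      \<and> x k \<le> y \<and> y \<le> x k + h" if "a \<le> y" for y
  proof -
    define k where "k = nat \<lfloor>(y - a) / h\<rfloor>"
    have k: "real k \<le> (y - a) / h" "(y - a) / h < real k + 1"
      using that h by (auto simp: k_def)
    then have xk: "x k \<le> y" "y < x k + h"
      using h by (auto simp: x_def field_simps)
    have le: "x j \<le> y" if "j \<le> k" for j
    proof -
      have "x j \<le> x k" using that h by (simp add: x_def)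
      with xk show ?thesis by simp
    qed
    have ge: "y \<le> x j" if "\<not> j \<le> k" for j
    proof -
      have "x (Suc k) \<le> x j" using that h by (simp add: x_def del: of_nat_Suc)
      with xk show ?thesis by (simp add: xS)
    qed
    have "(\<Sum>j. ennreal (e j) * ennreal (y - x j)) = (\<Sum>j\<le>k. ennreal (e j) * ennreal (y - x j))"
      using ge by (intro suminf_finite) (auto simp: ennreal_neg)
    also have "\<dots> = (\<Sum>j\<le>k. ennreal (e j * (y - x j)))"
      using e0 le by (intro sum.cong) (auto simp: ennreal_mult)
    also have "\<dots> = ennreal (\<Sum>j\<le>k. e j * (y - x j))"
      using e0 le by (intro sum_ennreal) auto
    finally show ?thesis using xk unfolding part by (intro exI[of _ k]) auto
  qed
  show ?thesis
  proof (rule that[of e x])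
    show "0 \<le> e j" for j by (rule e0)
    fix y assume "a \<le> y"
    then obtain k where k: "(\<Sum>j. ennreal (e j) * ennreal (y - x j)) = ennreal (g (x k - h) - g (a - h) + d k * (y - x k))"
      "x k \<le> y" "y \<le> x k + h"
      using val by blast
    \<comment> \<open>On the cell [x k, x k + h] the function rises from
      \<open>g (x k - h) - g (a - h)\<close> to at most \<open>g (x k) - g (a - h)\<close>. The
      lower value and \<open>y \<le> x k + h\<close> give the shift by 2 h; the upper one and
      \<open>x k \<le> y\<close> give the bound by \<open>g\<close>, with the constant coming from
      the cell before \<open>a\<close>.\<close>
    have "g (y - 2 * h) \<le> g (x k - h)" "g (a - h) \<le> g a" using k h by (auto intro!: g_mono)
    moreover have "0 \<le> d k * (y - x k)" using d0 k by simp
    ultimately show "ennreal (g (y - 2 * h) - g a) \<le> (\<Sum>j. ennreal (e j) * ennreal (y - x j))"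
      unfolding k(1) by (intro ennreal_leI) linarith
    have "d k * (y - x k) \<le> d k * h" using k d0 by (intro mult_left_mono) auto
    also have "\<dots> = g (x k) - g (x k - h)" using h by (simp add: d_def)
    also have "g (x k) \<le> g y" using k by (intro g_mono)
    finally have "g (x k - h) - g (a - h) + d k * (y - x k) \<le> (g y - g a) + (g a - g (a - h))" by simp
    moreover have "0 \<le> g y - g a" "0 \<le> g a - g (a - h)"
      using g_mono[of a y] g_mono[of "a - h" a] h \<open>a \<le> y\<close> by auto
    ultimately show "(\<Sum>j. ennreal (e j) * ennreal (y - x j)) \<le> ennreal (g y - g a) + ennreal (g a - g (a - h))"
      unfolding k(1) by (subst ennreal_plus[symmetric]) (auto intro: ennreal_leI)
  qed
qed

text \<open>\<open>ennreal\<close> sends negative reals to 0, so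
  \<open>ennreal (R \<omega> - c)\<close> is the positive part of the excess over \<open>c\<close>.
  The hypothesis is applied to each ramp in the sandwich for \<open>g\<close>; sum and integral
  commute as all terms are non-negative. As the mesh tends to 0, monotone convergence removes the
  shift, and continuity of \<open>g\<close> at \<open>a\<close> removes the constant.\<close>

lemma increasing_convex_order:
  fixes S :: "'a \<Rightarrow> real" and R :: "'b \<Rightarrow> real" and g :: "real \<Rightarrow> real"
  assumes "prob_space M" "prob_space N" and g: "mono g" "convex_on UNIV g"
    and S[measurable]: "S \<in> borel_measurable M" and R[measurable]: "R \<in> borel_measurable N"
    and aS: "AE \<omega> in M. a \<le> S \<omega>" and aR: "AE \<omega> in N. a \<le> R \<omega>"
    and le: "\<And>c. (\<integral>\<^sup>+\<omega>. ennreal (R \<omega> - c) \<partial>N) \<le> (\<integral>\<^sup>+\<omega>. ennreal (S \<omega> - c) \<partial>M)"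
  shows "(\<integral>\<^sup>+\<omega>. ennreal (g (R \<omega>) - g a) \<partial>N) \<le> (\<integral>\<^sup>+\<omega>. ennreal (g (S \<omega>) - g a) \<partial>M)"
proof -
  interpret M: prob_space M by fact
  interpret N: prob_space N by fact
  have cont: "continuous_on UNIV g" using g(2) by (intro convex_on_continuous) auto
  have [measurable]: "g \<in> borel_measurable borel" using cont by (rule borel_measurable_continuous_onI)
  define h where "h n = inverse (real (Suc n))" for n
  have h: "0 < h n" for n by (simp add: h_def)
  have h0: "h \<longlonglongrightarrow> 0" unfolding h_def by (rule LIMSEQ_inverse_real_of_nat)
  have "(\<integral>\<^sup>+\<omega>. ennreal (g (R \<omega> - 2 * h n) - g a) \<partial>N)
      \<le> (\<integral>\<^sup>+\<omega>. ennreal (g (S \<omega>) - g a) \<partial>M) + ennreal (g a - g (a - h n))" for n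
  proof -
    obtain e x where e: "\<And>j. 0 \<le> e j"
      and lo: "\<And>y. a \<le> y \<Longrightarrow> ennreal (g (y - 2 * h n) - g a) \<le> (\<Sum>j. ennreal (e j) * ennreal (y - x j))"
      and up: "\<And>y. a \<le> y \<Longrightarrow> (\<Sum>j. ennreal (e j) * ennreal (y - x j)) \<le> ennreal (g y - g a) + ennreal (g a - g (a - h n))"
      using convex_piecewise_linear[OF g h[of n], where a = a] by blast
    have "(\<integral>\<^sup>+\<omega>. ennreal (g (R \<omega> - 2 * h n) - g a) \<partial>N) \<le> (\<integral>\<^sup>+\<omega>. (\<Sum>j. ennreal (e j) * ennreal (R \<omega> - x j)) \<partial>N)"
      using aR by (intro nn_integral_mono_AE) (auto elim!: eventually_mono intro: lo)
    also have "\<dots> = (\<Sum>j. ennreal (e j) * (\<integral>\<^sup>+\<omega>. ennreal (R \<omega> - x j) \<partial>N))"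
      by (subst nn_integral_suminf) (auto simp: nn_integral_cmult)
    also have "\<dots> \<le> (\<Sum>j. ennreal (e j) * (\<integral>\<^sup>+\<omega>. ennreal (S \<omega> - x j) \<partial>M))"
      using le by (intro suminf_le mult_left_mono) auto
    also have "\<dots> = (\<integral>\<^sup>+\<omega>. (\<Sum>j. ennreal (e j) * ennreal (S \<omega> - x j)) \<partial>M)"
      by (subst nn_integral_suminf) (auto simp: nn_integral_cmult)
    also have "\<dots> \<le> (\<integral>\<^sup>+\<omega>. ennreal (g (S \<omega>) - g a) + ennreal (g a - g (a - h n)) \<partial>M)"
      using aS by (intro nn_integral_mono_AE) (auto elim!: eventually_mono intro: up)
    also have "\<dots> = (\<integral>\<^sup>+\<omega>. ennreal (g (S \<omega>) - g a) \<partial>M) + ennreal (g a - g (a - h n))"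
      by (subst nn_integral_add) (auto simp: M.emeasure_space_1)
    finally show ?thesis .
  qed
  moreover have "(\<lambda>n. \<integral>\<^sup>+\<omega>. ennreal (g (R \<omega> - 2 * h n) - g a) \<partial>N) \<longlonglongrightarrow> (\<integral>\<^sup>+\<omega>. ennreal (g (R \<omega>) - g a) \<partial>N)"
  proof (rule nn_integral_LIMSEQ)
    show "incseq (\<lambda>n \<omega>. ennreal (g (R \<omega> - 2 * h n) - g a))"
      using g by (auto simp: incseq_def le_fun_def h_def intro!: ennreal_leI monoD[of g] le_imp_inverse_le)
    show "(\<lambda>n. ennreal (g (R \<omega> - 2 * h n) - g a)) \<longlonglongrightarrow> ennreal (g (R \<omega>) - g a)" for \<omega>
    proof (rule tendsto_ennrealI)
      have "(\<lambda>n. R \<omega> - 2 * h n) \<longlonglongrightarrow> R \<omega> - 2 * 0" by (intro tendsto_intros h0)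
      then have "(\<lambda>n. g (R \<omega> - 2 * h n)) \<longlonglongrightarrow> g (R \<omega>)"
        using continuous_on_tendsto_compose[OF cont, of "\<lambda>n. R \<omega> - 2 * h n" "R \<omega>"] by simp
      then show "(\<lambda>n. g (R \<omega> - 2 * h n) - g a) \<longlonglongrightarrow> g (R \<omega>) - g a" by (intro tendsto_intros)
    qed
  qed measurable
  moreover have "(\<lambda>n. (\<integral>\<^sup>+\<omega>. ennreal (g (S \<omega>) - g a) \<partial>M) + ennreal (g a - g (a - h n)))
      \<longlonglongrightarrow> (\<integral>\<^sup>+\<omega>. ennreal (g (S \<omega>) - g a) \<partial>M) + ennreal 0"
  proof (intro tendsto_add tendsto_const tendsto_ennrealI)
    have "(\<lambda>n. a - h n) \<longlonglongrightarrow> a - 0" by (intro tendsto_intros h0)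
    then have "(\<lambda>n. g (a - h n)) \<longlonglongrightarrow> g a"
      using continuous_on_tendsto_compose[OF cont, of "\<lambda>n. a - h n" a] by simp
    then have "(\<lambda>n. g a - g (a - h n)) \<longlonglongrightarrow> g a - g a" by (intro tendsto_intros)
    then show "(\<lambda>n. g a - g (a - h n)) \<longlonglongrightarrow> 0" by simp
  qed
  ultimately show ?thesis by (intro LIMSEQ_le) auto
qed

text \<open>A lower bound keeps the integral of the negative part finite, so the difference in
  \<open>ext_expectation\<close> is never infinity minus infinity. Inequalities between extended
  expectations thus reduce to inequalities between non-negative integrals.\<close>

lemma ext_expectation_eq:
  assumes "prob_space M" and [measurable]: "f \<in> borel_measurable M"
    and \<xi>: "AE \<omega> in M. \<xi> \<omega> = f \<omega>" and c: "AE \<omega> in M. c \<le> f \<omega>"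
  shows "ext_expectation M \<xi> = enn2ereal (\<integral>\<^sup>+\<omega>. ennreal (f \<omega> - c) \<partial>M) + ereal c"
proof -
  interpret prob_space M by fact
  define P where "P = (\<integral>\<^sup>+\<omega>. ennreal (max (f \<omega>) 0) \<partial>M)"
  define Q where "Q = (\<integral>\<^sup>+\<omega>. ennreal (max (- f \<omega>) 0) \<partial>M)"
  define A where "A = (\<integral>\<^sup>+\<omega>. ennreal (f \<omega> - c) \<partial>M)"
  have "ext_expectation M \<xi> = enn2ereal P - enn2ereal Q"
    unfolding ext_expectation_def nn_integral_completion P_def Q_def using \<xi>
    by (intro arg_cong2[where f = "(-)"] arg_cong[where f = enn2ereal] nn_integral_cong_AE)
      (auto elim: eventually_mono)
  \<comment> \<open>Where c <= f, with + and - denoting positive and negative parts, f+ + c- = (f -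
    c) + f- + c+ holds pointwise; it is arranged without subtraction of integrals that may be
    infinite.\<close>
  moreover have "P + ennreal (max (-c) 0) = A + Q + ennreal (max c 0)"
  proof -
    have "P + ennreal (max (-c) 0) = (\<integral>\<^sup>+\<omega>. ennreal (max (f \<omega>) 0) + ennreal (max (-c) 0) \<partial>M)"
      unfolding P_def by (subst nn_integral_add) (auto simp: emeasure_space_1)
    also have "\<dots> = (\<integral>\<^sup>+\<omega>. ennreal (f \<omega> - c) + ennreal (max (- f \<omega>) 0) + ennreal (max c 0) \<partial>M)"
      using c by (intro nn_integral_cong_AE)
        (auto elim!: eventually_mono simp: max_def simp flip: ennreal_plus)
    also have "\<dots> = A + Q + ennreal (max c 0)"
      unfolding A_def Q_def by (simp add: nn_integral_add emeasure_space_1)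
    finally show ?thesis .
  qed
  moreover have "Q < top"
  proof -
    have "Q \<le> (\<integral>\<^sup>+\<omega>. ennreal (max (-c) 0) \<partial>M)"
      unfolding Q_def using c by (intro nn_integral_mono_AE) (auto elim!: eventually_mono intro!: ennreal_leI)
    then show ?thesis by (auto simp: emeasure_space_1 intro: le_less_trans)
  qed
  ultimately show ?thesis
    unfolding A_def[symmetric]
    by (cases P; cases Q; cases A) (auto simp: max_def enn2ereal_ennreal ennreal_plus[symmetric] simp del: ennreal_plus split: if_splits)
qed

text \<open>Tonelli for the region t <= u < S \<omega>; this links the tail integrals to the
  expected excesses.\<close>

lemma nn_integral_tail:
  fixes S :: "'a \<Rightarrow> real"
  assumes "prob_space M" and [measurable]: "S \<in> borel_measurable M"
  shows "(\<integral>\<^sup>+u\<in>{t..}. emeasure M {\<omega>\<in>space M. S \<omega> > u} \<partial>lborel) = (\<integral>\<^sup>+\<omega>. ennreal (S \<omega> - t) \<partial>M)"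
proof -
  interpret prob_space M by fact
  interpret pair_sigma_finite M lborel ..
  have "(\<integral>\<^sup>+u\<in>{t..}. emeasure M {\<omega>\<in>space M. S \<omega> > u} \<partial>lborel)
    = (\<integral>\<^sup>+u. (\<integral>\<^sup>+\<omega>. indicator {t..<S \<omega>} u \<partial>M) \<partial>lborel)"
  proof (rule nn_integral_cong)
    fix u
    have "emeasure M {\<omega>\<in>space M. S \<omega> > u} * indicator {t..} u
        = (\<integral>\<^sup>+\<omega>. indicator {\<omega>\<in>space M. S \<omega> > u} \<omega> * indicator {t..} u \<partial>M)"
      by (simp add: nn_integral_multc)
    also have "\<dots> = (\<integral>\<^sup>+\<omega>. indicator {t..<S \<omega>} u \<partial>M)"
      by (intro nn_integral_cong) (auto simp: indicator_def)
    finally show "emeasure M {\<omega>\<in>space M. S \<omega> > u} * indicator {t..} u = (\<integral>\<^sup>+\<omega>. indicator {t..<S \<omega>} u \<partial>M)" .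
  qed
  also have "\<dots> = (\<integral>\<^sup>+\<omega>. (\<integral>\<^sup>+u. indicator {t..<S \<omega>} u \<partial>lborel) \<partial>M)"
  proof (rule Fubini')
    have "(\<lambda>z. if t \<le> snd z \<and> snd z < S (fst z) then 1 else 0 :: ennreal) \<in> borel_measurable (M \<Otimes>\<^sub>M lborel)"
      by measurable
    then show "(\<lambda>(\<omega>, u). indicator {t..<S \<omega>} u :: ennreal) \<in> borel_measurable (M \<Otimes>\<^sub>M lborel)"
      by (rule measurable_cong[THEN iffD1, rotated]) (auto simp: indicator_def)
  qed
  also have "\<dots> = (\<integral>\<^sup>+\<omega>. ennreal (S \<omega> - t) \<partial>M)"
    proof (rule nn_integral_cong)
    show "(\<integral>\<^sup>+u. indicator {t..<S \<omega>} u \<partial>lborel) = ennreal (S \<omega> - t)" for \<omega>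
      by (cases "t \<le> S \<omega>") (auto simp: ennreal_neg)
  qed
  finally show ?thesis .
qed

lemma emeasure_completion_AE_eq:
  assumes [measurable]: "A \<in> sets M" and AB: "AE \<omega> in M. \<omega> \<in> B \<longleftrightarrow> \<omega> \<in> A" and B: "B \<subseteq> space M"
  shows "emeasure (completion M) B = emeasure M A"
proof -
  have "B \<in> sets (completion M)"
  proof (rule completion.in_sets_AE)
    show "AE \<omega> in completion M. \<omega> \<in> A \<longleftrightarrow> \<omega> \<in> B"
      using AB by (intro AE_completion) (auto elim: eventually_mono)
  qed (use B in auto)
  then have "emeasure (completion M) B = emeasure (completion M) A"
    using AB by (intro emeasure_eq_AE AE_completion) auto
  then show ?thesis by simp
qed

section \<open>Suprema of paths\<close>

lemma Max_tendsto_SUP: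
  fixes f :: "real \<Rightarrow> real" and q :: "nat \<Rightarrow> real"
  assumes f: "continuous_on {a..b} f" and q: "range q \<subseteq> {a..b}" "{a..b} \<subseteq> closure (range q)"
  shows "(\<lambda>n. Max ((\<lambda>j. f (q j)) ` {..n})) \<longlonglongrightarrow> (SUP t\<in>{a..b}. f t)"
proof -
  have qj: "q j \<in> {a..b}" for j by (rule subsetD[OF q(1) rangeI])
  then have ne: "{a..b} \<noteq> {}" by blast
  have "compact (f ` {a..b})" using f by (intro compact_continuous_image) auto
  then have bdd: "bdd_above (f ` {a..b})" by (intro bounded_imp_bdd_above compact_imp_bounded)
  define M where "M n = Max ((\<lambda>j. f (q j)) ` {..n})" for n
  have M_le: "M n \<le> (SUP t\<in>{a..b}. f t)" for n
    unfolding M_def using qj bdd by (intro Max.boundedI) (auto intro!: cSUP_upper simp del: atLeastAtMost_iff)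
  then have bddM: "bdd_above (range M)" by (intro bdd_aboveI[of _ "SUP t\<in>{a..b}. f t"]) auto
  have "incseq M"
    unfolding M_def incseq_def by (auto intro!: Max_mono)
  then have lim: "M \<longlonglongrightarrow> (SUP n. M n)" by (intro LIMSEQ_incseq_SUP bddM)
  have cl: "closure (range q) = {a..b}"
    using q by (intro antisym closure_minimal) auto
  have "f t \<le> (SUP n. M n)" if "t \<in> {a..b}" for t
  proof (rule continuous_le_on_closure[where S = "range q" and f = f])
    fix x assume "x \<in> range q"
    then obtain n where "x = q n" by auto
    then have "f x \<le> M n" unfolding M_def by (intro Max_ge) auto
    also have "M n \<le> (SUP n. M n)" using bddM by (intro cSUP_upper) auto
    finally show "f x \<le> (SUP n. M n)" .
  qed (use f cl that in auto)
  then have "(SUP t\<in>{a..b}. f t) \<le> (SUP n. M n)" using ne by (intro cSUP_least) auto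
  moreover have "(SUP n. M n) \<le> (SUP t\<in>{a..b}. f t)" using M_le by (intro cSUP_least) auto
  ultimately have "(SUP n. M n) = (SUP t\<in>{a..b}. f t)" by (rule antisym[rotated])
  with lim have "M \<longlonglongrightarrow> (SUP t\<in>{a..b}. f t)" by simp
  then show ?thesis by (simp only: M_def[abs_def])
qed

text \<open>\<open>S\<close> is the limit of the maxima over the first terms of \<open>q\<close>.
  Taken with \<open>lim\<close>, it is measurable everywhere, whatever value \<open>lim\<close> has
  on the null set of discontinuous paths. The truncated maxima are non-negative and increasing, so
  monotone convergence gives the last formula.\<close>

lemma path_sup_measurable_version:
  fixes q :: "nat \<Rightarrow> real"
  assumes Z: "\<forall>t\<in>{0..T}. Z t \<in> borel_measurable M"
    and cont: "AE \<omega> in M. continuous_on {0..T} (\<lambda>t. Z t \<omega>)"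
    and q: "range q \<subseteq> {0..T}" "{0..T} \<subseteq> closure (range q)"
  obtains S where "S \<in> borel_measurable M" and "AE \<omega> in M. path_sup T Z \<omega> = S \<omega>"
    and "\<And>c. (\<integral>\<^sup>+\<omega>. ennreal (S \<omega> - c) \<partial>M)
            = (SUP n. \<integral>\<^sup>+\<omega>. ennreal (Max ((\<lambda>j. Z (q j) \<omega>) ` {..n}) - c) \<partial>M)"
proof -
  define X where "X n \<omega> = Max ((\<lambda>j. Z (q j) \<omega>) ` {..n})" for n \<omega>
  have Zq: "Z (q j) \<in> borel_measurable M" for j by (intro Z[rule_format] subsetD[OF q(1) rangeI])
  have X[measurable]: "X n \<in> borel_measurable M" for n
    unfolding X_def using Zq by (intro borel_measurable_Max) auto
  define S where "S \<omega> = lim (\<lambda>n. X n \<omega>)" for \<omega>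
  have lim: "AE \<omega> in M. (\<lambda>n. X n \<omega>) \<longlonglongrightarrow> path_sup T Z \<omega>"
    using cont by eventually_elim (auto simp: X_def path_sup_def intro!: Max_tendsto_SUP q)
  then have eq: "AE \<omega> in M. path_sup T Z \<omega> = S \<omega>"
    by eventually_elim (auto simp: S_def dest: limI)
  have inc: "incseq (\<lambda>n. ennreal (X n \<omega> - c))" for \<omega> c
    unfolding X_def incseq_def by (auto intro!: ennreal_leI Max_mono)
  have "(\<integral>\<^sup>+\<omega>. ennreal (S \<omega> - c) \<partial>M) = (SUP n. \<integral>\<^sup>+\<omega>. ennreal (X n \<omega> - c) \<partial>M)" for c
  proof -
    have "(\<integral>\<^sup>+\<omega>. ennreal (S \<omega> - c) \<partial>M) = (\<integral>\<^sup>+\<omega>. (SUP n. ennreal (X n \<omega> - c)) \<partial>M)"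
    proof (rule nn_integral_cong_AE)
      show "AE \<omega> in M. ennreal (S \<omega> - c) = (SUP n. ennreal (X n \<omega> - c))"
        using lim eq
      proof eventually_elim
        fix \<omega> assume "(\<lambda>n. X n \<omega>) \<longlonglongrightarrow> path_sup T Z \<omega>" "path_sup T Z \<omega> = S \<omega>"
        then have "(\<lambda>n. ennreal (X n \<omega> - c)) \<longlonglongrightarrow> ennreal (S \<omega> - c)"
          by (intro tendsto_ennrealI tendsto_diff) auto
        with LIMSEQ_SUP[OF inc[of \<omega> c]] show "ennreal (S \<omega> - c) = (SUP n. ennreal (X n \<omega> - c))"
          by (rule LIMSEQ_unique[rotated])
      qed
    qed
    also have "\<dots> = (SUP n. \<integral>\<^sup>+\<omega>. ennreal (X n \<omega> - c) \<partial>M)"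
      using inc by (intro nn_integral_monotone_convergence_SUP) (auto simp: incseq_def le_fun_def)
    finally show ?thesis .
  qed
  moreover have "S \<in> borel_measurable M"
    unfolding S_def by (intro borel_measurable_lim_metric X)
  ultimately show ?thesis using that[of S] eq by (simp add: X_def)
qed

lemma centered_gaussian_process_zero:
  assumes X: "centered_gaussian_process_cov M I C X" and i: "i \<in> I" "C i i = 0"
  shows "AE \<omega> in M. X i \<omega> = 0"
proof -
  have "(\<integral>\<omega>. X i \<omega> * X i \<omega> \<partial>M) = 0" using X i by (simp add: centered_gaussian_process_cov_def)
  then have "AE \<omega> in M. X i \<omega> * X i \<omega> = 0"
    using centered_gaussian_process_integrable_mult[OF X i(1) i(1)]
    by (subst (asm) integral_nonneg_eq_0_iff_AE) auto
  then show ?thesis by eventually_elim auto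
qed

text \<open>The constant \<open>c\<close> enters as one further index of the Gaussian vector, namely time \<open>0\<close>
  with mean \<open>c\<close>: the processes vanish there.\<close>

lemma Max_excess_le:
  fixes q :: "nat \<Rightarrow> real"
  assumes M: "prob_space M" and N: "prob_space N" and T: "0 \<le> T"
    and X: "centered_gaussian_process_cov M {0..T} C X" and Y: "centered_gaussian_process_cov N {0..T} D Y"
    and C0: "C 0 0 = 0" and D0: "D 0 0 = 0"
    and inc: "\<forall>s\<in>{0..T}. \<forall>t\<in>{0..T}. D s s + D t t - 2 * D s t \<le> C s s + C t t - 2 * C s t"
    and q: "range q \<subseteq> {0..T}"
  shows "(\<integral>\<^sup>+\<omega>. ennreal (Max ((\<lambda>j. Y (q j) \<omega> + m (q j)) ` {..n}) - c) \<partial>N)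
       \<le> (\<integral>\<^sup>+\<omega>. ennreal (Max ((\<lambda>j. X (q j) \<omega> + m (q j)) ` {..n}) - c) \<partial>M)"
proof -
  define \<tau> where "\<tau> j = (if j \<le> n then q j else 0)" for j
  define \<mu> where "\<mu> j = (if j \<le> n then m (q j) else c)" for j
  have \<tau>: "\<tau> j \<in> {0..T}" for j using T subsetD[OF q rangeI, of j] by (simp add: \<tau>_def)
  \<comment> \<open>Almost surely the enlarged maximum is max c x, where x is the maximum over
    \<open>q\<close>, and max c x - c is the positive part of x - c. The enlarged maximum is
    integrable, so the real-valued comparison of expectations carries over to non-negative
    integrals.\<close>
  have main: "(\<integral>\<^sup>+\<omega>. ennreal (Max ((\<lambda>j. Z (q j) \<omega> + m (q j)) ` {..n}) - c) \<partial>P)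
      = ennreal ((\<integral>\<omega>. Max ((\<lambda>j. Z (\<tau> j) \<omega> + \<mu> j) ` {..Suc n}) \<partial>P) - c)"
    if P: "prob_space P" and Z: "centered_gaussian_process_cov P {0..T} E Z" and E0: "E 0 0 = 0"
    for P :: "'z measure" and Z E
  proof -
    interpret prob_space P by fact
    define V where "V \<omega> = Max ((\<lambda>j. Z (\<tau> j) \<omega> + \<mu> j) ` {..Suc n})" for \<omega>
    have iV: "integrable P V"
      unfolding V_def using centered_gaussian_process_integrable(2)[OF Z \<tau>] by (intro integrable_Max) auto
    have Z0: "AE \<omega> in P. Z 0 \<omega> = 0" using centered_gaussian_process_zero[OF Z _ E0] T by simp
    have V: "V \<omega> = max c (Max ((\<lambda>j. Z (q j) \<omega> + m (q j)) ` {..n}))" if "Z 0 \<omega> = 0" for \<omega>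
    proof -
      have "(\<lambda>j. Z (\<tau> j) \<omega> + \<mu> j) ` {..Suc n} = insert c ((\<lambda>j. Z (q j) \<omega> + m (q j)) ` {..n})"
        using that by (auto simp: atMost_Suc \<tau>_def \<mu>_def image_iff)
      then show ?thesis by (simp add: V_def)
    qed
    have cV: "AE \<omega> in P. 0 \<le> V \<omega> - c" using Z0 by eventually_elim (simp add: V)
    have pos: "ennreal (x - c) = ennreal (max c x - c)" for x
      by (cases "c \<le> x") (auto simp: ennreal_neg)
    have "(\<integral>\<^sup>+\<omega>. ennreal (Max ((\<lambda>j. Z (q j) \<omega> + m (q j)) ` {..n}) - c) \<partial>P) = (\<integral>\<^sup>+\<omega>. ennreal (V \<omega> - c) \<partial>P)"
      using Z0 by (intro nn_integral_cong_AE) (auto elim!: eventually_mono simp only: V intro: pos)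
    also have "\<dots> = ennreal (\<integral>\<omega>. V \<omega> - c \<partial>P)"
      using iV cV by (intro nn_integral_eq_integral) auto
    also have "(\<integral>\<omega>. V \<omega> - c \<partial>P) = (\<integral>\<omega>. V \<omega> \<partial>P) - c" using iV by (simp add: prob_space)
    finally show ?thesis by (simp add: V_def)
  qed
  have "(\<integral>\<omega>. Max ((\<lambda>j. Y (\<tau> j) \<omega> + \<mu> j) ` {..Suc n}) \<partial>N) \<le> (\<integral>\<omega>. Max ((\<lambda>j. X (\<tau> j) \<omega> + \<mu> j) ` {..Suc n}) \<partial>M)"
    by (rule Sudakov_Fernique[OF M N _ _ centered_gaussian_process_reindex[OF X, where \<tau> = \<tau>]
          centered_gaussian_process_reindex[OF Y, where \<tau> = \<tau>]])
      (use \<tau> inc in auto)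
  then show ?thesis
    unfolding main[OF M X C0] main[OF N Y D0] by (intro ennreal_leI) simp
qed

text \<open>The expected excesses over all levels decide both conclusions: they feed the increasing
  convex order for \<open>g\<close>, and at level \<open>t\<close> they equal the tail
  integrals.\<close>

theorem path_sup_convex_order:
  fixes X :: "real \<Rightarrow> 'a \<Rightarrow> real" and Y :: "real \<Rightarrow> 'b \<Rightarrow> real" and m :: "real \<Rightarrow> real"
  assumes M: "prob_space M" and N: "prob_space N" and T: "0 \<le> T"
    and X: "centered_gaussian_process_cov M {0..T} C X" and Y: "centered_gaussian_process_cov N {0..T} D Y"
    and C0: "C 0 0 = 0" and D0: "D 0 0 = 0"
    and inc: "\<forall>s\<in>{0..T}. \<forall>t\<in>{0..T}. D s s + D t t - 2 * D s t \<le> C s s + C t t - 2 * C s t"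
    and contX: "AE \<omega> in M. continuous_on {0..T} (\<lambda>t. X t \<omega>)"
    and contY: "AE \<omega> in N. continuous_on {0..T} (\<lambda>t. Y t \<omega>)"
    and m: "continuous_on {0..T} m"
  shows "\<And>g. mono g \<Longrightarrow> convex_on UNIV g \<Longrightarrow>
      ext_expectation N (\<lambda>\<omega>. g (path_sup T (\<lambda>t \<omega>. Y t \<omega> + m t) \<omega>))
      \<le> ext_expectation M (\<lambda>\<omega>. g (path_sup T (\<lambda>t \<omega>. X t \<omega> + m t) \<omega>))"
    and "\<And>t. (\<integral>\<^sup>+u\<in>{t..}. emeasure (completion N) {\<omega>\<in>space N. path_sup T (\<lambda>t \<omega>. Y t \<omega> + m t) \<omega> > u} \<partial>lborel)
      \<le> (\<integral>\<^sup>+u\<in>{t..}. emeasure (completion M) {\<omega>\<in>space M. path_sup T (\<lambda>t \<omega>. X t \<omega> + m t) \<omega> > u} \<partial>lborel)"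
proof -
  interpret M: prob_space M by fact
  interpret N: prob_space N by fact
  let ?X = "\<lambda>t \<omega>. X t \<omega> + m t" and ?Y = "\<lambda>t \<omega>. Y t \<omega> + m t"
  obtain A :: "real set" where A: "countable A" "A \<subseteq> {0..T}" "{0..T} \<subseteq> closure A"
    by (rule separable)
  have "A \<noteq> {}"
  proof
    assume "A = {}"
    with A(3) have "{0..T} \<subseteq> {}" by (simp only: closure_empty)
    with T show False by simp
  qed
  define q where "q = from_nat_into A"
  have "range q = A" unfolding q_def by (rule range_from_nat_into[OF \<open>A \<noteq> {}\<close> A(1)])
  then have q: "range q \<subseteq> {0..T}" "{0..T} \<subseteq> closure (range q)" using A(2,3) by (simp_all only:)
  have "\<forall>t\<in>{0..T}. X t \<in> borel_measurable M" "\<forall>t\<in>{0..T}. Y t \<in> borel_measurable N"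
    using X Y unfolding centered_gaussian_process_cov_def gaussian_process_def by blast+
  then have meas: "\<forall>t\<in>{0..T}. ?X t \<in> borel_measurable M" "\<forall>t\<in>{0..T}. ?Y t \<in> borel_measurable N"
    by (auto intro!: borel_measurable_add simp del: atLeastAtMost_iff)
  have cont: "AE \<omega> in M. continuous_on {0..T} (\<lambda>t. ?X t \<omega>)" "AE \<omega> in N. continuous_on {0..T} (\<lambda>t. ?Y t \<omega>)"
    using contX contY m by (auto elim!: eventually_mono intro!: continuous_on_add)
  obtain S where S[measurable]: "S \<in> borel_measurable M" and eqS: "AE \<omega> in M. path_sup T ?X \<omega> = S \<omega>"
    and SUPS: "\<And>c. (\<integral>\<^sup>+\<omega>. ennreal (S \<omega> - c) \<partial>M)
            = (SUP n. \<integral>\<^sup>+\<omega>. ennreal (Max ((\<lambda>j. ?X (q j) \<omega>) ` {..n}) - c) \<partial>M)"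
    by (rule path_sup_measurable_version[OF meas(1) cont(1) q]) (rule that)
  obtain R where R[measurable]: "R \<in> borel_measurable N" and eqR: "AE \<omega> in N. path_sup T ?Y \<omega> = R \<omega>"
    and SUPR: "\<And>c. (\<integral>\<^sup>+\<omega>. ennreal (R \<omega> - c) \<partial>N)
            = (SUP n. \<integral>\<^sup>+\<omega>. ennreal (Max ((\<lambda>j. ?Y (q j) \<omega>) ` {..n}) - c) \<partial>N)"
    by (rule path_sup_measurable_version[OF meas(2) cont(2) q]) (rule that)
  have le: "(\<integral>\<^sup>+\<omega>. ennreal (R \<omega> - c) \<partial>N) \<le> (\<integral>\<^sup>+\<omega>. ennreal (S \<omega> - c) \<partial>M)" for c
    unfolding SUPS SUPR using Max_excess_le[OF M N T X Y C0 D0 inc q(1)] by (intro SUP_mono) blast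
  \<comment> \<open>\<open>m 0\<close> is a common lower bound of both suprema and plays the part of
    \<open>a\<close> in the convex order. Continuity bounds the path, so that the supremum really
    dominates its value at time 0.\<close>
  have lower: "m 0 \<le> path_sup T (\<lambda>t \<omega>. Z t \<omega> + m t) \<omega>"
    if "Z 0 \<omega> = 0" "continuous_on {0..T} (\<lambda>t. Z t \<omega> + m t)" for Z :: "real \<Rightarrow> 'z \<Rightarrow> real" and \<omega>
  proof -
    have "compact ((\<lambda>t. Z t \<omega> + m t) ` {0..T})" using that by (intro compact_continuous_image) auto
    then have "bdd_above ((\<lambda>t. Z t \<omega> + m t) ` {0..T})" by (intro bounded_imp_bdd_above compact_imp_bounded)
    then have "Z 0 \<omega> + m 0 \<le> path_sup T (\<lambda>t \<omega>. Z t \<omega> + m t) \<omega>"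
      unfolding path_sup_def using T by (intro cSUP_upper) auto
    with that show ?thesis by simp
  qed
  have lo: "AE \<omega> in M. m 0 \<le> S \<omega>" "AE \<omega> in N. m 0 \<le> R \<omega>"
  proof -
    have "AE \<omega> in M. X 0 \<omega> = 0" "AE \<omega> in N. Y 0 \<omega> = 0"
      using centered_gaussian_process_zero[OF X _ C0] centered_gaussian_process_zero[OF Y _ D0] T by auto
    note zero = this
    show "AE \<omega> in M. m 0 \<le> S \<omega>"
      using zero(1) cont(1) eqS
    proof eventually_elim
      case (elim \<omega>)
      then show ?case using lower[of X \<omega>] by simp
    qed
    show "AE \<omega> in N. m 0 \<le> R \<omega>"
      using zero(2) cont(2) eqR
    proof eventually_elim
      case (elim \<omega>)
      then show ?case using lower[of Y \<omega>] by simp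
    qed
  qed
  show "ext_expectation N (\<lambda>\<omega>. g (path_sup T ?Y \<omega>)) \<le> ext_expectation M (\<lambda>\<omega>. g (path_sup T ?X \<omega>))"
    if g: "mono g" "convex_on UNIV g" for g
  proof -
    have "continuous_on UNIV g" using g(2) by (intro convex_on_continuous) auto
    then have [measurable]: "g \<in> borel_measurable borel" by (rule borel_measurable_continuous_onI)
    have "ext_expectation M (\<lambda>\<omega>. g (path_sup T ?X \<omega>)) = enn2ereal (\<integral>\<^sup>+\<omega>. ennreal (g (S \<omega>) - g (m 0)) \<partial>M) + ereal (g (m 0))"
    proof (rule ext_expectation_eq[OF M])
      show "AE \<omega> in M. g (path_sup T ?X \<omega>) = g (S \<omega>)" using eqS by eventually_elim simp
      show "AE \<omega> in M. g (m 0) \<le> g (S \<omega>)" using lo(1) by eventually_elim (rule monoD[OF g(1)])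
    qed measurable
    moreover have "ext_expectation N (\<lambda>\<omega>. g (path_sup T ?Y \<omega>)) = enn2ereal (\<integral>\<^sup>+\<omega>. ennreal (g (R \<omega>) - g (m 0)) \<partial>N) + ereal (g (m 0))"
    proof (rule ext_expectation_eq[OF N])
      show "AE \<omega> in N. g (path_sup T ?Y \<omega>) = g (R \<omega>)" using eqR by eventually_elim simp
      show "AE \<omega> in N. g (m 0) \<le> g (R \<omega>)" using lo(2) by eventually_elim (rule monoD[OF g(1)])
    qed measurable
    moreover have "(\<integral>\<^sup>+\<omega>. ennreal (g (R \<omega>) - g (m 0)) \<partial>N) \<le> (\<integral>\<^sup>+\<omega>. ennreal (g (S \<omega>) - g (m 0)) \<partial>M)"
      by (rule increasing_convex_order[OF M N g S R lo le])
    ultimately show ?thesis by (simp add: add_right_mono less_eq_ennreal.rep_eq)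
  qed
  have "emeasure (completion M) {\<omega>\<in>space M. path_sup T ?X \<omega> > u} = emeasure M {\<omega>\<in>space M. S \<omega> > u}" for u
    using eqS by (intro emeasure_completion_AE_eq) (auto elim: eventually_mono)
  moreover have "emeasure (completion N) {\<omega>\<in>space N. path_sup T ?Y \<omega> > u} = emeasure N {\<omega>\<in>space N. R \<omega> > u}" for u
    using eqR by (intro emeasure_completion_AE_eq) (auto elim: eventually_mono)
  ultimately show "(\<integral>\<^sup>+u\<in>{t..}. emeasure (completion N) {\<omega>\<in>space N. path_sup T ?Y \<omega> > u} \<partial>lborel)
      \<le> (\<integral>\<^sup>+u\<in>{t..}. emeasure (completion M) {\<omega>\<in>space M. path_sup T ?X \<omega> > u} \<partial>lborel)" for t
    using le[of t] by (simp add: nn_integral_tail[OF M S] nn_integral_tail[OF N R])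
qed

text \<open>\<open>d = 0\<close> yields the supremum truncated below at \<open>c\<close>, and
  \<open>c = 0\<close> the positive part of the excess over \<open>d\<close>.\<close>

lemma mono_convex_max:
  fixes c d :: real
  shows "mono (\<lambda>x::real. max (x - d) c)" and "convex_on UNIV (\<lambda>x::real. max (x - d) c)"
proof -
  show "mono (\<lambda>x::real. max (x - d) c)" by (auto simp: mono_def)
  show "convex_on UNIV (\<lambda>x::real. max (x - d) c)"
  proof (rule convex_onI)
    fix t x y :: real assume t: "0 < t" "t < 1"
    have "(1 - t) * (x - d) + t * (y - d) \<le> (1 - t) * max (x - d) c + t * max (y - d) c"
      "(1 - t) * c + t * c \<le> (1 - t) * max (x - d) c + t * max (y - d) c"
      using t by (intro add_mono mult_left_mono; simp)+
    moreover have "(1 - t) * (x - d) + t * (y - d) = (1 - t) *\<^sub>R x + t *\<^sub>R y - d" "(1 - t) * c + t * c = c"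
      by (simp_all add: algebra_simps)
    ultimately show "max ((1 - t) *\<^sub>R x + t *\<^sub>R y - d) c \<le> (1 - t) * max (x - d) c + t * max (y - d) c"
      by simp
  qed simp
qed

theorem theorem2p12:
  fixes H K T :: real
    and M :: "'a measure" and N :: "'b measure"
    and W :: "real \<Rightarrow> 'a \<Rightarrow> real" and B Y :: "real \<Rightarrow> 'b \<Rightarrow> real"
    and m :: "real \<Rightarrow> real"
  assumes "0 < H" and "H < 1" and "0 < K" and "K \<le> 1" and "0 < T"
    and "prob_space M" and "prob_space N"
    and "bifractional_BM M H K W"
    and "AE \<omega> in M. continuous_on {0..T} (\<lambda>t. W t \<omega>)"
    and "fractional_BM N (H * K) B"
    and "AE \<omega> in N. continuous_on {0..T} (\<lambda>t. B t \<omega>)"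
    and "\<And>t \<omega>. t \<in> {0..T} \<Longrightarrow> \<omega> \<in> space N \<Longrightarrow> Y t \<omega> = 2 powr (- K / 2) * B t \<omega>"
    and "continuous_on {0..T} m"
  shows
    "(\<forall>c. ext_expectation M (\<lambda>\<omega>. max (path_sup T (\<lambda>t \<omega>. W t \<omega> + m t) \<omega>) c)
          \<ge> ext_expectation N (\<lambda>\<omega>. max (path_sup T (\<lambda>t \<omega>. Y t \<omega> + m t) \<omega>) c)) \<and>
     (\<forall>g. mono g \<and> convex_on UNIV g \<longrightarrow>
          ext_expectation M (\<lambda>\<omega>. g (path_sup T (\<lambda>t \<omega>. W t \<omega> + m t) \<omega>))
          \<ge> ext_expectation N (\<lambda>\<omega>. g (path_sup T (\<lambda>t \<omega>. Y t \<omega> + m t) \<omega>))) \<and>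
     (\<forall>t\<in>{0..T}.
          (\<integral>\<^sup>+u\<in>{t..}. emeasure (completion M) {\<omega> \<in> space M. path_sup T W \<omega> > u} \<partial>lborel)
          \<ge> (\<integral>\<^sup>+u\<in>{t..}. emeasure (completion N) {\<omega> \<in> space N. path_sup T Y \<omega> > u} \<partial>lborel)) \<and>
     (\<forall>t\<in>{0..T}.
          ext_expectation M (\<lambda>\<omega>. max (path_sup T W \<omega> - t) 0)
          \<ge> ext_expectation N (\<lambda>\<omega>. max (path_sup T Y \<omega> - t) 0))"
proof -
  define C where "C = (\<lambda>s t::real. 1 / 2 powr K * ((t powr (2 * H) + s powr (2 * H)) powr K - \<bar>s - t\<bar> powr (2 * H * K)))"
  define E where "E = (\<lambda>s t::real. 1 / 2 * (t powr (2 * (H * K)) + s powr (2 * (H * K)) - \<bar>t - s\<bar> powr (2 * (H * K))))"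
  define D where "D = (\<lambda>s t. (2 powr (- K / 2))\<^sup>2 * E s t)"
  have "centered_gaussian_process_cov M {0..} C W" "centered_gaussian_process_cov N {0..} E B"
    using assms by (simp_all add: bifractional_BM_def fractional_BM_def C_def E_def)
  \<comment> \<open>\<open>Y\<close> is tied to \<open>B\<close> only on [0, T], so the index set is
    cut down by reindexing along the identity.\<close>
  then have W: "centered_gaussian_process_cov M {0..T} C W" and B: "centered_gaussian_process_cov N {0..T} E B"
    using centered_gaussian_process_reindex[where \<tau> = "\<lambda>t. t" and I = "{0..T}" and T = "{0..}"] by auto
  have Y: "centered_gaussian_process_cov N {0..T} D Y"
    unfolding D_def using assms by (intro centered_gaussian_process_scale[OF B]) auto
  have c2: "(2 powr (- K / 2))\<^sup>2 = 1 / 2 powr K"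
    by (simp add: power2_eq_square powr_minus_divide flip: powr_add)
  have inc: "\<forall>s\<in>{0..T}. \<forall>t\<in>{0..T}. D s s + D t t - 2 * D s t \<le> C s s + C t t - 2 * C s t"
  proof (intro ballI)
    fix s t assume st: "s \<in> {0..T}" "t \<in> {0..T}"
    have "E s s + E t t - 2 * E s t = \<bar>t - s\<bar> powr (2 * H * K)"
      by (simp add: E_def mult.assoc field_simps)
    then have "D s s + D t t - 2 * D s t = 1 / 2 powr K * \<bar>t - s\<bar> powr (2 * H * K)"
      unfolding D_def c2 by (simp add: field_simps)
    \<comment> \<open>One of the two copies of \<open>\<bar>t - s\<bar> powr (2 * H * K)\<close> on
      the right matches the left-hand side; the remaining terms are non-negative by
      \<open>bifractional_increment_ge\<close>.\<close>
    also have "\<dots> \<le> 1 / 2 powr K * ((2 * t powr (2*H)) powr K + (2 * s powr (2*H)) powr K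
        - 2 * ((t powr (2*H) + s powr (2*H)) powr K) + 2 * \<bar>t - s\<bar> powr (2 * H * K))"
      using bifractional_increment_ge[of H K s t] assms st by (intro mult_left_mono) auto
    also have "\<dots> = C s s + C t t - 2 * C s t"
      by (simp add: C_def abs_minus_commute[of s t] diff_divide_distrib add_divide_distrib flip: mult_2)
    finally show "D s s + D t t - 2 * D s t \<le> C s s + C t t - 2 * C s t" .
  qed
  have zero: "C 0 0 = 0" "D 0 0 = 0" using assms by (simp_all add: C_def D_def E_def)
  have contY: "AE \<omega> in N. continuous_on {0..T} (\<lambda>t. Y t \<omega>)"
    using assms(11) AE_space
  proof eventually_elim
    case (elim \<omega>)
    then have "continuous_on {0..T} (\<lambda>t. 2 powr (- K / 2) * B t \<omega>)" by (intro continuous_intros)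
    then show ?case by (rule continuous_on_eq) (use assms(12) elim in simp)
  qed
  have T: "0 \<le> T" using assms by simp
  note order = path_sup_convex_order[OF \<open>prob_space M\<close> \<open>prob_space N\<close> T W Y zero inc assms(9) contY]
  note order_m = order[OF \<open>continuous_on {0..T} m\<close>]
  \<comment> \<open>The last two claims are about the processes themselves, that is, the drift
    0.\<close>
  have 0: "continuous_on {0..T} (\<lambda>_. 0 :: real)" by simp
  note order_0 = order[OF 0]
  show ?thesis
  proof (intro conjI allI ballI impI)
    show "ext_expectation N (\<lambda>\<omega>. max (path_sup T (\<lambda>t \<omega>. Y t \<omega> + m t) \<omega>) c)
        \<le> ext_expectation M (\<lambda>\<omega>. max (path_sup T (\<lambda>t \<omega>. W t \<omega> + m t) \<omega>) c)" for c
      using order_m(1)[OF mono_convex_max[of 0 c]] by simp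
    show "ext_expectation N (\<lambda>\<omega>. g (path_sup T (\<lambda>t \<omega>. Y t \<omega> + m t) \<omega>))
        \<le> ext_expectation M (\<lambda>\<omega>. g (path_sup T (\<lambda>t \<omega>. W t \<omega> + m t) \<omega>))" if "mono g \<and> convex_on UNIV g" for g
      using order_m(1) that by blast
    show "(\<integral>\<^sup>+u\<in>{t..}. emeasure (completion N) {\<omega> \<in> space N. path_sup T Y \<omega> > u} \<partial>lborel)
        \<le> (\<integral>\<^sup>+u\<in>{t..}. emeasure (completion M) {\<omega> \<in> space M. path_sup T W \<omega> > u} \<partial>lborel)" for t
      using order_0(2)[of t] by simp
    show "ext_expectation N (\<lambda>\<omega>. max (path_sup T Y \<omega> - t) 0)
        \<le> ext_expectation M (\<lambda>\<omega>. max (path_sup T W \<omega> - t) 0)" for t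
      using order_0(1)[OF mono_convex_max[of t 0]] by simp
  qed
qed

end
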